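(* Let $\{\mathcal{D}_l\}_{l\ge 1}$ be a real-valued, centered, stationary and ergodic process such that for every $n$ the vector $D^n=(\mathcal{D}_1,\ldots,\mathcal{D}_n)$ has a density $f^n$ on $\mathbb{R}^n$ with finite differential entropy, and such that the differential entropy rate $h(\mathcal{D})=\lim_{n\to\infty}\frac1n h(D^n)$ exists and is finite. Let $c(\mathcal{D})=-h(\mathcal{D})$. For each $n$ let $\mu^n$ be a stationary and ergodic point process on $\mathbb{R}^n$ with normalized logarithmic intensity $R_n$, and suppose there is a subsequence $n_k\to\infty$ with $\liminf_{k\to\infty}R_{n_k}>c(\mathcal{D})$. Then for all choices of decoding regions $\{\mathcal{C}_k^n\}_k$ which are subsets of $\mathbb{R}^n$ jointly stationary with the points of $\mu^n$ and forming a decomposition of $\mathbb{R}^n$, the probability of error satisfies $\lim_{k\to\infty}p_e(n_k)=1$.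
   Context: All logarithms are natural. For each $n$, $\mu^n=\sum_k\epsilon_{T_k^n}$ is a simple stationary ergodic point process on $\mathbb{R}^n$ with intensity $\lambda_n\in(0,\infty)$; its normalized logarithmic intensity $R_n$ is defined by $\lambda_n=e^{nR_n}$. $\mathbb{P}_0^n$ denotes its Palm probability, under which $T_0^n=0$. Each point $T_k^n$ carries a displacement vector $D_k^n\in\mathbb{R}^n$; the $D_k^n$ are i.i.d. in $k$, distributed as $D^n$, and independent of the points and of the decoding regions. Decoding regions: to each point $T_k^n$ is attached, as a mark (so that points and regions are jointly stationary under translations of $\mathbb{R}^n$), a set $\mathcal{C}_k^n\subset\mathbb{R}^n$; forming a decomposition (tessellation) of $\mathbb{R}^n$ means that the regions are pairwise disjoint open sets whose closures cover $\mathbb{R}^n$. The probability of error is $p_e(n)=\mathbb{P}_0^n(D_0^n\notin\mathcal{C}_0^n)$ (the asymptotic fraction of points with $T_k^n+D_k^n\notin\mathcal{C}_k^n$). *)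

theory Defs
  imports "HOL-Probability.Probability"
begin

section \<open>Euclidean space of variable dimension\<close>

text \<open>The dimension \<open>n\<close> varies inside the statement, so a vector of R^n is a function on
  \<open>{..<n}\<close>, extended by \<open>undefined\<close> outside (an element of the extensional product). The
  coordinates are numbered from 0.\<close>

type_synonym vec = "nat \<Rightarrow> real"

definition euclid :: "nat \<Rightarrow> vec measure" where
  "euclid n = (\<Pi>\<^sub>M i\<in>{..<n}. lborel)"

definition euclid_top :: "nat \<Rightarrow> vec topology" where
  "euclid_top n = product_topology (\<lambda>_. euclideanreal) {..<n}"

definition vorigin :: "nat \<Rightarrow> vec" where
  "vorigin n = (\<lambda>i\<in>{..<n}. 0)"

definition vneg :: "nat \<Rightarrow> vec \<Rightarrow> vec" where
  "vneg n x = (\<lambda>i\<in>{..<n}. - x i)"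

definition vshift :: "nat \<Rightarrow> vec \<Rightarrow> vec \<Rightarrow> vec" where
  "vshift n x y = (\<lambda>i\<in>{..<n}. y i + x i)"

definition unit_cube :: "nat \<Rightarrow> vec set" where
  "unit_cube n = (\<Pi>\<^sub>E i\<in>{..<n}. {0..<1})"


section \<open>Marked point processes\<close>

text \<open>A point process with marks is given by labelled random elements \<open>X k\<close> of a measurable space
  \<open>S\<close> (a point together with its marks), where \<open>pos s\<close> is the location of \<open>s\<close> in R^n and \<open>sh x s\<close>
  is the translate of \<open>s\<close> by \<open>x\<close>. The labels are the natural numbers: a stationary ergodic point
  process of positive intensity on R^n, \<open>n \<ge> 1\<close>, almost surely has infinitely many points.\<close>

definition point_process ::
  "nat \<Rightarrow> 'w measure \<Rightarrow> 's measure \<Rightarrow> ('s \<Rightarrow> vec) \<Rightarrow> (nat \<Rightarrow> 'w \<Rightarrow> 's) \<Rightarrow> bool" where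
  "point_process n M S pos X \<longleftrightarrow>
     prob_space M \<and> (\<forall>k. X k \<in> M \<rightarrow>\<^sub>M S) \<and>
     (\<forall>\<omega>\<in>space M. \<forall>a. finite {k. \<forall>i<n. \<bar>pos (X k \<omega>) i\<bar> \<le> a})"

text \<open>The sum of the Dirac measures at the \<open>X k \<omega>\<close>.\<close>

definition point_measure :: "'s measure \<Rightarrow> (nat \<Rightarrow> 'w \<Rightarrow> 's) \<Rightarrow> 'w \<Rightarrow> 's measure" where
  "point_measure S X \<omega> = distr (count_space UNIV) S (\<lambda>k. X k \<omega>)"

text \<open>The space of counting measures with locally finite ground measure, with the
  \<open>\<sigma>\<close>-algebra generated by the evaluations on measurable sets.\<close>

definition counting_algebra :: "nat \<Rightarrow> 's measure \<Rightarrow> ('s \<Rightarrow> vec) \<Rightarrow> 's measure measure" where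
  "counting_algebra n S pos =
     (SUP A \<in> sets S. vimage_algebra
        {\<nu>. sets \<nu> = sets S \<and>
             (\<forall>B\<in>sets S. emeasure \<nu> B = \<infinity> \<or> emeasure \<nu> B \<in> \<nat>) \<and>
             (\<forall>a. emeasure \<nu> {s\<in>space S. \<forall>i<n. \<bar>pos s i\<bar> \<le> a} < \<infinity>)}
        (\<lambda>\<nu>. emeasure \<nu> A) borel)"

definition stationary_pp ::
  "nat \<Rightarrow> 'w measure \<Rightarrow> 's measure \<Rightarrow> ('s \<Rightarrow> vec) \<Rightarrow> (vec \<Rightarrow> 's \<Rightarrow> 's) \<Rightarrow>
     (nat \<Rightarrow> 'w \<Rightarrow> 's) \<Rightarrow> bool" where
  "stationary_pp n M S pos sh X \<longleftrightarrow>
     point_process n M S pos X \<and>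
     (\<forall>x\<in>space (euclid n).
        distr M (counting_algebra n S pos) (\<lambda>\<omega>. distr (point_measure S X \<omega>) S (sh x)) =
        distr M (counting_algebra n S pos) (point_measure S X))"

definition ergodic_pp ::
  "nat \<Rightarrow> 'w measure \<Rightarrow> 's measure \<Rightarrow> ('s \<Rightarrow> vec) \<Rightarrow> (vec \<Rightarrow> 's \<Rightarrow> 's) \<Rightarrow>
     (nat \<Rightarrow> 'w \<Rightarrow> 's) \<Rightarrow> bool" where
  "ergodic_pp n M S pos sh X \<longleftrightarrow>
     (\<forall>\<Gamma>\<in>sets (counting_algebra n S pos).
        (\<forall>x\<in>space (euclid n). \<forall>\<nu>\<in>space (counting_algebra n S pos).
            distr \<nu> S (sh x) \<in> \<Gamma> \<longleftrightarrow> \<nu> \<in> \<Gamma>) \<longrightarrow>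
        measure M {\<omega>\<in>space M. point_measure S X \<omega> \<in> \<Gamma>} \<in> {0, 1})"

definition intensity ::
  "nat \<Rightarrow> 'w measure \<Rightarrow> ('s \<Rightarrow> vec) \<Rightarrow> (nat \<Rightarrow> 'w \<Rightarrow> 's) \<Rightarrow> ennreal" where
  "intensity n M pos X = (\<integral>\<^sup>+\<omega>. (\<Sum>k. indicator (unit_cube n) (pos (X k \<omega>))) \<partial>M)"

text \<open>Palm probability of an event \<open>\<Gamma>\<close> on the space of counting measures: the
  expected number of points in the unit cube from which the translated configuration belongs to
  \<open>\<Gamma>\<close>, divided by the intensity.\<close>

definition palm_prob ::
  "nat \<Rightarrow> 'w measure \<Rightarrow> 's measure \<Rightarrow> ('s \<Rightarrow> vec) \<Rightarrow> (vec \<Rightarrow> 's \<Rightarrow> 's) \<Rightarrow>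
     (nat \<Rightarrow> 'w \<Rightarrow> 's) \<Rightarrow> 's measure set \<Rightarrow> real" where
  "palm_prob n M S pos sh X \<Gamma> = enn2real (
     (\<integral>\<^sup>+\<omega>. (\<Sum>k. indicator (unit_cube n) (pos (X k \<omega>)) *
        indicator \<Gamma> (distr (point_measure S X \<omega>) S (sh (vneg n (pos (X k \<omega>)))))) \<partial>M)
     / intensity n M pos X)"


section \<open>Decoding regions and displacements\<close>

text \<open>The space of open subsets of R^n, with the \<open>\<sigma>\<close>-algebra generated by the events that a compact
  set is contained in the open set (by complementation, the Borel \<open>\<sigma>\<close>-algebra of the Fell
  topology on closed sets).\<close>

definition region_space :: "nat \<Rightarrow> vec set measure" where
  "region_space n = sigma {U. openin (euclid_top n) U}
     {{U. openin (euclid_top n) U \<and> K \<subseteq> U} |K. compactin (euclid_top n) K}"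

abbreviation points_regions :: "nat \<Rightarrow> (vec \<times> vec set) measure" where
  "points_regions n \<equiv> euclid n \<Otimes>\<^sub>M region_space n"

definition shift_pr :: "nat \<Rightarrow> vec \<Rightarrow> vec \<times> vec set \<Rightarrow> vec \<times> vec set" where
  "shift_pr n x = (\<lambda>(t, U). (vshift n x t, vshift n x ` U))"

text \<open>Triples of a point, its displacement and its region; displacements are relative to the
  point, so translations do not act on them.\<close>

abbreviation points_disps_regions :: "nat \<Rightarrow> (vec \<times> vec \<times> vec set) measure" where
  "points_disps_regions n \<equiv> euclid n \<Otimes>\<^sub>M (euclid n \<Otimes>\<^sub>M region_space n)"

definition shift_pdr :: "nat \<Rightarrow> vec \<Rightarrow> vec \<times> vec \<times> vec set \<Rightarrow> vec \<times> vec \<times> vec set" where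
  "shift_pdr n x = (\<lambda>(t, d, U). (vshift n x t, d, vshift n x ` U))"

definition simple_stationary_ergodic ::
  "nat \<Rightarrow> 'w measure \<Rightarrow> (nat \<Rightarrow> 'w \<Rightarrow> vec) \<Rightarrow> bool" where
  "simple_stationary_ergodic n M T \<longleftrightarrow>
     stationary_pp n M (euclid n) id (vshift n) T \<and>
     ergodic_pp n M (euclid n) id (vshift n) T \<and>
     (AE \<omega> in M. inj (\<lambda>k. T k \<omega>))"

definition jointly_stationary_regions ::
  "nat \<Rightarrow> 'w measure \<Rightarrow> (nat \<Rightarrow> 'w \<Rightarrow> vec) \<Rightarrow> (nat \<Rightarrow> 'w \<Rightarrow> vec set) \<Rightarrow> bool" where
  "jointly_stationary_regions n M T C \<longleftrightarrow>
     stationary_pp n M (points_regions n) fst (shift_pr n) (\<lambda>k \<omega>. (T k \<omega>, C k \<omega>))"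

definition decomposition :: "nat \<Rightarrow> (nat \<Rightarrow> vec set) \<Rightarrow> bool" where
  "decomposition n U \<longleftrightarrow>
     (\<forall>k. openin (euclid_top n) (U k)) \<and> disjoint_family U \<and>
     (\<Union>k. euclid_top n closure_of U k) = topspace (euclid_top n)"

definition iid_displacements ::
  "nat \<Rightarrow> 'w measure \<Rightarrow> (nat \<Rightarrow> 'w \<Rightarrow> vec) \<Rightarrow> (nat \<Rightarrow> 'w \<Rightarrow> vec set) \<Rightarrow>
     (nat \<Rightarrow> 'w \<Rightarrow> vec) \<Rightarrow> vec measure \<Rightarrow> bool" where
  "iid_displacements n M T C D L \<longleftrightarrow>
     prob_space.indep_vars M (\<lambda>_. euclid n) D UNIV \<and>
     (\<forall>k. distr M (euclid n) (D k) = L) \<and>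
     prob_space.indep_set M
       (sets (vimage_algebra (space M) (\<lambda>\<omega> k. D k \<omega>) (\<Pi>\<^sub>M k\<in>UNIV. euclid n)))
       (sets (vimage_algebra (space M) (\<lambda>\<omega> k. (T k \<omega>, C k \<omega>))
          (\<Pi>\<^sub>M k\<in>UNIV. points_regions n)))"

text \<open>Under the Palm probability there is a point at the origin, with displacement \<open>d\<close> and region
  \<open>U\<close>; the error event is that \<open>d\<close> is not in \<open>U\<close>.\<close>

definition error_event :: "nat \<Rightarrow> (vec \<times> vec \<times> vec set) measure set" where
  "error_event n = {\<nu> \<in> space (counting_algebra n (points_disps_regions n) fst).
     emeasure \<nu> {(t, d, U) \<in> space (points_disps_regions n). t = vorigin n \<and> d \<notin> U} \<noteq> 0}"

definition error_prob ::
  "nat \<Rightarrow> 'w measure \<Rightarrow> (nat \<Rightarrow> 'w \<Rightarrow> vec) \<Rightarrow> (nat \<Rightarrow> 'w \<Rightarrow> vec) \<Rightarrow>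
     (nat \<Rightarrow> 'w \<Rightarrow> vec set) \<Rightarrow> real" where
  "error_prob n M T D C =
     palm_prob n M (points_disps_regions n) fst (shift_pdr n)
       (\<lambda>k \<omega>. (T k \<omega>, D k \<omega>, C k \<omega>)) (error_event n)"


section \<open>The displacement process\<close>

text \<open>A process indexed by \<open>l \<ge> 1\<close> is represented by \<open>X :: nat \<Rightarrow> _\<close>, its \<open>l\<close>-th variable being
  \<open>X (l - 1)\<close>.\<close>

definition path_law :: "'v measure \<Rightarrow> (nat \<Rightarrow> 'v \<Rightarrow> real) \<Rightarrow> (nat \<Rightarrow> real) measure" where
  "path_law N X = distr N (\<Pi>\<^sub>M l\<in>UNIV. borel) (\<lambda>\<omega> l. X l \<omega>)"

definition stationary_sequence :: "'v measure \<Rightarrow> (nat \<Rightarrow> 'v \<Rightarrow> real) \<Rightarrow> bool" where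
  "stationary_sequence N X \<longleftrightarrow>
     (\<forall>l. X l \<in> borel_measurable N) \<and> path_law N (\<lambda>l. X (Suc l)) = path_law N X"

definition ergodic_sequence :: "'v measure \<Rightarrow> (nat \<Rightarrow> 'v \<Rightarrow> real) \<Rightarrow> bool" where
  "ergodic_sequence N X \<longleftrightarrow>
     (\<forall>A\<in>sets (\<Pi>\<^sub>M l\<in>UNIV. borel). (\<lambda>x l. x (Suc l)) -` A = A \<longrightarrow>
        measure (path_law N X) A \<in> {0, 1})"

definition init_vec :: "(nat \<Rightarrow> 'v \<Rightarrow> real) \<Rightarrow> nat \<Rightarrow> 'v \<Rightarrow> vec" where
  "init_vec X n \<omega> = (\<lambda>i\<in>{..<n}. X i \<omega>)"

text \<open>Entropy in nats, with respect to Lebesgue measure: minus the integral of \<open>f ln f\<close> when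
  \<open>init_vec X n\<close> has density \<open>f\<close>.\<close>

definition diff_entropy :: "'v measure \<Rightarrow> (nat \<Rightarrow> 'v \<Rightarrow> real) \<Rightarrow> nat \<Rightarrow> real" where
  "diff_entropy N X n = prob_space.entropy N (exp 1) (euclid n) (init_vec X n)"

end

theory Submission
  imports Defs
begin

text \<open>Let \<open>L\<close> be the law of the displacement, with density \<open>f\<close>. Given its region \<open>U\<close>, a point \<open>t\<close> is
  decoded correctly with probability \<open>L (U - t) \<le> L {f > \<tau>} + \<tau> |U|\<close>, for any threshold \<open>\<tau>\<close>.
  Since the regions are disjoint and jointly stationary with the points, mass transport bounds the
  mean total volume of the regions of the points in the unit cube by 1, so that
  \<open>1 - p_e(n) \<le> L {f > \<tau>} + \<tau> / \<lambda>\<close>. Take \<open>\<tau> = exp (- n (h - d))\<close>: the second term vanishes as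
  \<open>R > - h\<close>, and the first does by the asymptotic equipartition property.

  Only one half of the latter is needed, namely that \<open>Y = - ln f(X_1, ..., X_n) / n\<close> is rarely much
  below \<open>h\<close>. As \<open>E Y\<close> tends to \<open>h\<close>, it is enough that the positive part of \<open>Y - h\<close> tends to 0 in
  mean, which follows by comparing \<open>f\<close> with a Markov density \<open>q\<close> of high order: \<open>E (q / f) \<le> 1\<close>, while
  \<open>- ln q\<close> is a Birkhoff sum up to a bounded number of terms.\<close>

section \<open>Euclidean space and windows\<close>

text \<open>The comparison with the Markov density q rests on ln z \<le> z - 1 at z = q / f: it
  gives - ln f \<le> - ln q + q / f, and the last term vanishes in mean after division by n. Hence
  only an upper bound on Birkhoff sums of G = - ln \<open>cond\<close> is wanted, which is why the
  ergodic theorem is one-sided. The mean of G is an increment of the block entropies; the averages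
  of these increments tend to h, so some order k has an increment at most h + e, and this k stays
  fixed while n grows. On the geometric side the labels carry no invariance, since stationarity
  equates laws of counting measures. It is therefore used only through expected numbers of pairs
  (point, region) with a given property. That the points are distinct enters at the Palm end: it
  makes the atom at the origin unique, so that the error event speaks about the very point to which
  the configuration was translated. The gap between - h and the rate is split in two equal parts d:
  one is spent on the concentration of f, the other leaves \<tau> / \<lambda> \<le> exp (- n
  d).\<close>

definition window :: "nat \<Rightarrow> nat \<Rightarrow> (nat \<Rightarrow> real) \<Rightarrow> vec" where
  "window i m x = (\<lambda>j\<in>{..<m}. x (i + j))"

lemma space_euclid: "space (euclid n) = extensional {..<n}"
  by (simp add: euclid_def space_PiM PiE_def)

lemma sigma_finite_euclid: "sigma_finite_measure (euclid n)"
proof -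
  interpret product_sigma_finite "\<lambda>_::nat. lborel :: real measure" ..
  show ?thesis unfolding euclid_def by (rule sigma_finite) simp
qed

lemma nn_integral_euclid_Suc:
  assumes "g \<in> borel_measurable (euclid (Suc n))"
  shows "(\<integral>\<^sup>+w. g w \<partial>euclid (Suc n)) = (\<integral>\<^sup>+v. (\<integral>\<^sup>+y. g (v(n := y)) \<partial>lborel) \<partial>euclid n)"
proof -
  interpret product_sigma_finite "\<lambda>_::nat. lborel :: real measure" ..
  show ?thesis
    using product_nn_integral_insert[of "{..<n}" n g] assms
    by (simp add: euclid_def lessThan_Suc)
qed

lemma measurable_euclidI:
  assumes "\<And>j. j < m \<Longrightarrow> (\<lambda>x. u x j) \<in> borel_measurable K"
    and "\<And>x. x \<in> space K \<Longrightarrow> u x \<in> extensional {..<m}"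
  shows "u \<in> K \<rightarrow>\<^sub>M euclid m"
  unfolding euclid_def
  by (rule measurable_PiM_single') (use assms in \<open>auto simp: PiE_def\<close>)

lemma measurable_euclid_component: "j < n \<Longrightarrow> (\<lambda>w. w j) \<in> borel_measurable (euclid n)"
  using measurable_component_singleton[of j "{..<n}" "\<lambda>_. lborel"] by (simp add: euclid_def)

lemma measurable_window [measurable]: "window i m \<in> (\<Pi>\<^sub>M l\<in>UNIV. borel) \<rightarrow>\<^sub>M euclid m"
  unfolding window_def
  by (rule measurable_euclidI) (auto intro!: measurable_component_singleton)

text \<open>Vectors are themselves functions on the naturals, so \<open>window\<close> cuts blocks
  out of sequences and out of vectors alike; the bound keeps it within the coordinates that carry a
  value.\<close>

lemma measurable_window_euclid: "i + m \<le> n \<Longrightarrow> window i m \<in> euclid n \<rightarrow>\<^sub>M euclid m"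
  unfolding window_def
  by (rule measurable_euclidI) (auto intro!: measurable_euclid_component)

text \<open>\<open>v(n := y)\<close> appends a coordinate to a vector of \<open>euclid n\<close>.
  The second form overwrites the last coordinate instead; it serves \<open>marg k\<close>, which is
  also evaluated on vectors with one more entry, an entry that it ignores.\<close>

lemma measurable_euclid_upd:
  "(\<lambda>(v, y). v(n := y)) \<in> euclid n \<Otimes>\<^sub>M lborel \<rightarrow>\<^sub>M euclid (Suc n)"
  "(\<lambda>(v, y). v(n := y)) \<in> euclid (Suc n) \<Otimes>\<^sub>M lborel \<rightarrow>\<^sub>M euclid (Suc n)"
proof -
  have "(\<lambda>x. (case x of (v, y) \<Rightarrow> v(n := y)) j) \<in> borel_measurable (euclid m \<Otimes>\<^sub>M lborel)"
    if "j < Suc n" "n \<le> m" for j m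
  proof (cases "j = n")
    case False
    then show ?thesis using that
      by (auto simp: case_prod_beta intro!: measurable_compose[OF measurable_fst] measurable_euclid_component)
  qed (simp add: case_prod_beta)
  then show "(\<lambda>(v, y). v(n := y)) \<in> euclid n \<Otimes>\<^sub>M lborel \<rightarrow>\<^sub>M euclid (Suc n)"
    "(\<lambda>(v, y). v(n := y)) \<in> euclid (Suc n) \<Otimes>\<^sub>M lborel \<rightarrow>\<^sub>M euclid (Suc n)"
    by (auto intro!: measurable_euclidI simp: space_pair_measure space_euclid extensional_def)
qed

lemma measurable_euclid_upd': "v \<in> space (euclid n) \<Longrightarrow> (\<lambda>y. v(n := y)) \<in> lborel \<rightarrow>\<^sub>M euclid (Suc n)"
  using measurable_compose[OF measurable_Pair1' measurable_euclid_upd(1)] by simp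

lemma window_in_space [simp]: "window i m x \<in> space (euclid m)"
  by (simp add: window_def space_euclid)

lemma window_upd: "i + m \<le> n \<Longrightarrow> window i m (v(n := y)) = window i m v"
  by (auto simp: window_def fun_eq_iff)

lemma window_Suc_upd: "(window i (Suc m) x)(m := y) = (window i m x)(m := y)"
  by (auto simp: window_def fun_eq_iff)

lemma window_upd_last: "window i (Suc m) (v(i + m := y)) = (window i m v)(m := y)"
  by (auto simp: window_def fun_eq_iff)

lemma window_window: "i + m \<le> n \<Longrightarrow> window i m (window 0 n x) = window i m x"
  by (auto simp: window_def fun_eq_iff)

lemma window_self: "w \<in> space (euclid n) \<Longrightarrow> window 0 n w = w"
  by (auto simp: window_def space_euclid fun_eq_iff extensional_def)

section \<open>A one-sided mean ergodic theorem\<close>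

text \<open>Ergodicity concerns strictly invariant sets, so a set to which it is applied must be
  invariant pointwise and not just up to null sets.\<close>

locale ergodic_map = prob_space P for P :: "'a measure" +
  fixes \<theta> :: "'a \<Rightarrow> 'a"
  assumes measurable_map [measurable]: "\<theta> \<in> P \<rightarrow>\<^sub>M P"
    and invariant: "distr P P \<theta> = P"
    and ergodic: "\<And>A. A \<in> sets P \<Longrightarrow> \<theta> -` A \<inter> space P = A \<Longrightarrow> measure P A \<in> {0, 1}"
begin

lemma integrable_map_iff:
  fixes g :: "'a \<Rightarrow> real"
  assumes "g \<in> borel_measurable P"
  shows "integrable P (\<lambda>x. g (\<theta> x)) \<longleftrightarrow> integrable P g"
  using integrable_distr_eq[OF measurable_map assms] invariant by simp

lemma integral_map:
  fixes g :: "'a \<Rightarrow> real"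
  assumes "g \<in> borel_measurable P"
  shows "(\<integral>x. g (\<theta> x) \<partial>P) = (\<integral>x. g x \<partial>P)"
  using integral_distr[OF measurable_map assms] invariant by simp

section \<open>Birkhoff sums and their running maxima\<close>

fun birkhoff_sum :: "('a \<Rightarrow> real) \<Rightarrow> nat \<Rightarrow> 'a \<Rightarrow> real" where
  "birkhoff_sum g 0 x = 0"
| "birkhoff_sum g (Suc n) x = g x + birkhoff_sum g n (\<theta> x)"

text \<open>This is the maximum of the Birkhoff sums of lengths 1 to \<open>n + 1\<close>. In the
  recursive form, \<open>birkhoff_max g (Suc n) x - birkhoff_max g n (\<theta> x)\<close> is visibly
  \<open>g x\<close> plus the negative part of \<open>birkhoff_max g n (\<theta> x)\<close>, the
  identity behind the maximal ergodic theorem.\<close>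

fun birkhoff_max :: "('a \<Rightarrow> real) \<Rightarrow> nat \<Rightarrow> 'a \<Rightarrow> real" where
  "birkhoff_max g 0 x = g x"
| "birkhoff_max g (Suc n) x = g x + max 0 (birkhoff_max g n (\<theta> x))"

lemma birkhoff_sum_fun: "birkhoff_sum g 0 = (\<lambda>_. 0)" "birkhoff_sum g (Suc n) = (\<lambda>x. g x + birkhoff_sum g n (\<theta> x))"
  and birkhoff_max_fun: "birkhoff_max g 0 = g" "birkhoff_max g (Suc n) = (\<lambda>x. g x + max 0 (birkhoff_max g n (\<theta> x)))"
  by (rule ext, simp)+

lemma birkhoff_sum_funpow: "birkhoff_sum g n x = (\<Sum>i<n. g ((\<theta> ^^ i) x))"
  by (induction n arbitrary: x)
    (simp_all add: sum.lessThan_Suc_shift funpow_Suc_right del: funpow.simps sum.lessThan_Suc)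

lemma birkhoff_sum_add: "birkhoff_sum (\<lambda>x. g x + g' x) n x = birkhoff_sum g n x + birkhoff_sum g' n x"
  by (induction n arbitrary: x) simp_all

lemma birkhoff_sum_diff_const: "birkhoff_sum (\<lambda>x. g x - c) n x = birkhoff_sum g n x - real n * c"
  by (induction n arbitrary: x) (simp_all add: algebra_simps)

lemma birkhoff_sum_nonneg: "(\<And>x. 0 \<le> g x) \<Longrightarrow> 0 \<le> birkhoff_sum g n x"
  by (induction n arbitrary: x) simp_all

lemma birkhoff_sum_le: "(\<And>x. g x \<le> b) \<Longrightarrow> birkhoff_sum g n x \<le> real n * b"
proof (induction n arbitrary: x)
  case (Suc n)
  have "birkhoff_sum g n (\<theta> x) \<le> real n * b" using Suc by blast
  then show ?case using Suc.prems[of x] by (simp add: algebra_simps)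
qed simp

lemma measurable_birkhoff_sum [measurable]:
  assumes [measurable]: "g \<in> borel_measurable P"
  shows "birkhoff_sum g n \<in> borel_measurable P"
proof (induction n)
  case (Suc n)
  note [measurable] = Suc
  show ?case by simp
qed simp

lemma integrable_birkhoff_sum: "integrable P g \<Longrightarrow> integrable P (birkhoff_sum g n)"
  by (induction n) (auto simp: birkhoff_sum_fun integrable_map_iff)

lemma integral_birkhoff_sum:
  assumes "integrable P g"
  shows "(\<integral>x. birkhoff_sum g n x \<partial>P) = real n * (\<integral>x. g x \<partial>P)"
proof (induction n)
  case (Suc n)
  have [measurable]: "birkhoff_sum g n \<in> borel_measurable P"
    using assms by auto
  show ?case using assms integrable_birkhoff_sum[OF assms, of n] Suc
    by (simp add: integrable_map_iff integral_map algebra_simps)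
qed simp

lemma integrable_birkhoff_max: "integrable P g \<Longrightarrow> integrable P (birkhoff_max g n)"
proof (induction n)
  case (Suc n)
  then have "integrable P (\<lambda>x. birkhoff_max g n (\<theta> x))" by (simp add: integrable_map_iff)
  with Suc.prems show ?case by (simp add: birkhoff_max_fun)
qed (simp add: birkhoff_max_fun)

lemma birkhoff_max_mono: "n \<le> m \<Longrightarrow> birkhoff_max g n x \<le> birkhoff_max g m x"
proof -
  have "birkhoff_max g n x \<le> birkhoff_max g (Suc n) x" for n x
  proof (induction n arbitrary: x)
    case (Suc n)
    show ?case using Suc[of "\<theta> x"] by (simp add: max_def)
  qed simp
  then show "n \<le> m \<Longrightarrow> birkhoff_max g n x \<le> birkhoff_max g m x"
    by (rule lift_Suc_mono_le)
qed

lemma birkhoff_sum_le_birkhoff_max: "birkhoff_sum g (Suc n) x \<le> birkhoff_max g n x"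
proof (induction n arbitrary: x)
  case (Suc n)
  show ?case using Suc[of "\<theta> x"] by simp
qed simp

text \<open>A zero-one argument: the points with unbounded maxima form an invariant set, and full
  measure is excluded because nonnegative integrals would then converge to the negative integral of
  \<open>g\<close>.\<close>

lemma AE_birkhoff_sum_bounded_above:
  assumes g: "integrable P g" and neg: "(\<integral>x. g x \<partial>P) < 0"
  shows "AE x in P. \<exists>B. \<forall>n. birkhoff_sum g n x \<le> B"
proof -
  have [measurable]: "g \<in> borel_measurable P" using g by simp
  have [measurable]: "birkhoff_max g n \<in> borel_measurable P" for n
    using integrable_birkhoff_max[OF g, of n] by simp
  \<comment> \<open>Bounds ranging over the naturals keep \<open>A\<close> a countable combination
    of measurable sets; \<open>A_iff\<close> restores real bounds.\<close>
  define A where "A = {x \<in> space P. \<forall>B::nat. \<exists>n. real B < birkhoff_max g n x}"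
  have A_iff: "x \<in> A \<longleftrightarrow> x \<in> space P \<and> (\<forall>B::real. \<exists>n. B < birkhoff_max g n x)" for x
  proof
    assume x: "x \<in> A"
    have "\<exists>n. B < birkhoff_max g n x" for B
    proof -
      obtain b :: nat where "B < real b" using reals_Archimedean2 by blast
      moreover obtain n where "real b < birkhoff_max g n x" using x unfolding A_def by blast
      ultimately show ?thesis using less_trans by blast
    qed
    then show "x \<in> space P \<and> (\<forall>B::real. \<exists>n. B < birkhoff_max g n x)" using x unfolding A_def by blast
  qed (simp add: A_def)
  have meas: "A \<in> sets P" unfolding A_def by measurable
  have "\<theta> x \<in> A \<longleftrightarrow> x \<in> A" if x: "x \<in> space P" for x
  proof
    assume *: "\<theta> x \<in> A"
    have "\<exists>n. B < birkhoff_max g n x" for B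
    proof -
      obtain n where "B - g x < birkhoff_max g n (\<theta> x)" using * A_iff by blast
      then have "B < birkhoff_max g (Suc n) x" by simp
      then show ?thesis by blast
    qed
    with x show "x \<in> A" by (subst A_iff) blast
  next
    assume *: "x \<in> A"
    have "\<exists>n. B < birkhoff_max g n (\<theta> x)" for B
    proof -
      \<comment> \<open>The summand \<bar>g x\<bar> rules out \<open>n = 0\<close>, and
        \<bar>B\<bar> \<ge> 0 forces the maximum with 0 in the recursion to be attained by the value
        at \<open>\<theta> x\<close>.\<close>
      obtain n where n: "\<bar>B\<bar> + \<bar>g x\<bar> < birkhoff_max g n x" using * A_iff by blast
      then obtain m where "n = Suc m" by (cases n) auto
      with n have "B < birkhoff_max g m (\<theta> x)" by (simp add: max_def split: if_splits)
      then show ?thesis by blast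
    qed
    with measurable_space[OF measurable_map x] show "\<theta> x \<in> A" by (subst A_iff) blast
  qed
  moreover have "A \<subseteq> space P" unfolding A_def by blast
  ultimately have inv_A: "\<theta> -` A \<inter> space P = A" by blast
  have cases: "prob A \<in> {0, 1}" by (rule ergodic[OF meas inv_A])
  have "prob A \<noteq> 1"
  proof
    assume "prob A = 1"
    then have AE_A: "AE x in P. x \<in> A" using prob_eq_1[OF meas] by simp
    \<comment> \<open>On \<open>A\<close> the increments \<open>birkhoff_max g (Suc n) - birkhoff_max g n \<circ> \<theta>\<close>, which have nonnegative
      integral, decrease to \<open>g\<close>.\<close>
    have "(\<lambda>n. \<integral>x. (birkhoff_max g (Suc n) x - birkhoff_max g n (\<theta> x)) \<partial>P) \<longlonglongrightarrow> (\<integral>x. g x \<partial>P)"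
    proof (rule integral_dominated_convergence[where w = "\<lambda>x. \<bar>g x\<bar> + \<bar>g (\<theta> x)\<bar>"])
      show "integrable P (\<lambda>x. \<bar>g x\<bar> + \<bar>g (\<theta> x)\<bar>)"
        using g by (simp add: integrable_map_iff)
      show "AE x in P. (\<lambda>n. birkhoff_max g (Suc n) x - birkhoff_max g n (\<theta> x)) \<longlonglongrightarrow> g x"
        using AE_A AE_space
      proof eventually_elim
        case (elim x)
        have "\<theta> x \<in> A" using elim inv_A by blast
        then obtain n where n: "0 < birkhoff_max g n (\<theta> x)" using A_iff by blast
        have "birkhoff_max g (Suc m) x - birkhoff_max g m (\<theta> x) = g x" if "m \<ge> n" for m
          using n birkhoff_max_mono[OF that, of g "\<theta> x"] by simp
        then have "\<forall>\<^sub>F m in sequentially. birkhoff_max g (Suc m) x - birkhoff_max g m (\<theta> x) = g x"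
          using eventually_sequentially by blast
        then show ?case by (rule tendsto_eventually)
      qed
      show "AE x in P. norm (birkhoff_max g (Suc n) x - birkhoff_max g n (\<theta> x)) \<le> \<bar>g x\<bar> + \<bar>g (\<theta> x)\<bar>" for n
      proof (rule AE_I2)
        fix x
        show "norm (birkhoff_max g (Suc n) x - birkhoff_max g n (\<theta> x)) \<le> \<bar>g x\<bar> + \<bar>g (\<theta> x)\<bar>"
          \<comment> \<open>The maxima increase from \<open>birkhoff_max g 0 = g\<close>, so their
            negative part at \<open>\<theta> x\<close> never exceeds \<bar>g (\<theta>
            x)\<bar>.\<close>
          using birkhoff_max_mono[of 0 n g "\<theta> x"] by (auto simp: max_def)
      qed
    qed measurable
    moreover have "0 \<le> (\<integral>x. (birkhoff_max g (Suc n) x - birkhoff_max g n (\<theta> x)) \<partial>P)" for n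
    proof -
      have "(\<integral>x. (birkhoff_max g (Suc n) x - birkhoff_max g n (\<theta> x)) \<partial>P)
          = (\<integral>x. birkhoff_max g (Suc n) x \<partial>P) - (\<integral>x. birkhoff_max g n (\<theta> x) \<partial>P)"
        using integrable_birkhoff_max[OF g, of n] integrable_birkhoff_max[OF g, of "Suc n"]
        by (intro Bochner_Integration.integral_diff) (auto simp: integrable_map_iff simp del: birkhoff_max.simps)
      also have "(\<integral>x. birkhoff_max g n (\<theta> x) \<partial>P) = (\<integral>x. birkhoff_max g n x \<partial>P)"
        by (rule integral_map) simp
      finally show ?thesis
        using integral_mono[OF integrable_birkhoff_max[OF g, of n] integrable_birkhoff_max[OF g, of "Suc n"] birkhoff_max_mono]
        by simp
    qed
    ultimately have "0 \<le> (\<integral>x. g x \<partial>P)" by (intro LIMSEQ_le_const) auto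
    with neg show False by simp
  qed
  with cases have "AE x in P. x \<notin> A" using prob_eq_0[OF meas] by simp
  with AE_space show ?thesis
  proof eventually_elim
    case (elim x)
    then have "\<not> (\<forall>B::real. \<exists>n. B < birkhoff_max g n x)" by (simp add: A_iff)
    then obtain B where B: "\<And>n. birkhoff_max g n x \<le> B" by (auto simp: not_less)
    have "birkhoff_sum g n x \<le> max 0 B" for n
    proof (cases n)
      case (Suc m)
      then show ?thesis using birkhoff_sum_le_birkhoff_max[of g m x] B[of m] by (metis le_max_iff_disj order_trans)
    qed simp
    then show ?case by blast
  qed
qed

text \<open>Subtracting slightly more than the mean makes the mean negative, so the sums are bounded
  above and their excess disappears after division by \<open>n\<close>. The surpluses 1 / (j + 1)
  are countably many, hence one null set serves all of them.\<close>

lemma AE_pos_part_average_tendsto: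
  assumes g: "integrable P g"
  shows "AE x in P. (\<lambda>n. max 0 (birkhoff_sum g n x / real n - (\<integral>x. g x \<partial>P))) \<longlonglongrightarrow> 0"
proof -
  let ?m = "\<integral>x. g x \<partial>P"
  have "AE x in P. \<exists>B. \<forall>n. birkhoff_sum (\<lambda>x. g x - (?m + inverse (real (Suc j)))) n x \<le> B" for j
    using g by (intro AE_birkhoff_sum_bounded_above) (auto simp: prob_space)
  then have "AE x in P. \<forall>j. \<exists>B. \<forall>n. birkhoff_sum (\<lambda>x. g x - (?m + inverse (real (Suc j)))) n x \<le> B"
    by (simp add: AE_all_countable)
  then show ?thesis
  proof eventually_elim
    case (elim x)
    show ?case
    proof (rule LIMSEQ_I)
      fix r :: real assume "0 < r"
      then obtain j where j: "inverse (real (Suc j)) < r / 2"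
        using reals_Archimedean[of "r / 2"] by auto
      obtain B where B: "\<And>n. birkhoff_sum g n x - real n * (?m + inverse (real (Suc j))) \<le> B"
        using elim unfolding birkhoff_sum_diff_const by blast
      obtain n0 :: nat where n0: "\<bar>B\<bar> / (r / 2) < real n0" using reals_Archimedean2 by blast
      have "norm (max 0 (birkhoff_sum g n x / real n - ?m) - 0) < r" if n: "n \<ge> max 1 n0" for n
      proof -
        have pos: "real n > 0" using n by auto
        have "\<bar>B\<bar> / (r / 2) < real n" using n0 n by linarith
        then have "\<bar>B\<bar> < real n * (r / 2)" using \<open>0 < r\<close> by (simp add: field_simps)
        moreover have "real n * inverse (real (Suc j)) \<le> real n * (r / 2)"
          using j pos by (intro mult_left_mono) auto
        ultimately have "birkhoff_sum g n x - real n * ?m < real n * r"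
          using B[of n] by (simp add: algebra_simps)
        then have "birkhoff_sum g n x / real n - ?m < r"
          using pos by (simp add: field_simps)
        then show ?thesis using \<open>0 < r\<close> by auto
      qed
      then show "\<exists>no. \<forall>n\<ge>no. norm (max 0 (birkhoff_sum g n x / real n - ?m) - 0) < r" by blast
    qed
  qed
qed

text \<open>A bound on \<open>g\<close> from above alone dominates the positive parts of the
  averages, so almost sure convergence passes to the mean.\<close>

lemma pos_part_average_L1_bounded:
  assumes g: "integrable P g" and b: "\<And>x. g x \<le> b"
  shows "(\<lambda>n. \<integral>x. max 0 (birkhoff_sum g n x / real n - (\<integral>x. g x \<partial>P)) \<partial>P) \<longlonglongrightarrow> 0"
proof -
  let ?m = "\<integral>x. g x \<partial>P"
  have [measurable]: "g \<in> borel_measurable P" using g by simp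
  have "(\<lambda>n. \<integral>x. max 0 (birkhoff_sum g n x / real n - ?m) \<partial>P) \<longlonglongrightarrow> (\<integral>x. 0 \<partial>P)"
  proof (rule integral_dominated_convergence[where w = "\<lambda>_. \<bar>b\<bar> + \<bar>?m\<bar>"])
    show "AE x in P. (\<lambda>n. max 0 (birkhoff_sum g n x / real n - ?m)) \<longlonglongrightarrow> 0"
      by (rule AE_pos_part_average_tendsto[OF g])
    have "birkhoff_sum g n x / real n \<le> \<bar>b\<bar>" for n x
    proof (cases "n = 0")
      case False
      then have "birkhoff_sum g n x / real n \<le> b" using birkhoff_sum_le[of g b n x, OF b] by (simp add: field_simps)
      then show ?thesis by simp
    qed simp
    then have "norm (max 0 (birkhoff_sum g n x / real n - ?m)) \<le> \<bar>b\<bar> + \<bar>?m\<bar>" for n x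
      unfolding real_norm_def by (smt (verit))
    then show "AE x in P. norm (max 0 (birkhoff_sum g n x / real n - ?m)) \<le> \<bar>b\<bar> + \<bar>?m\<bar>" for n
      by simp
  qed auto
  then show ?thesis by simp
qed

text \<open>Truncation from above is enough, as only positive parts are to be controlled. The part
  cut off is nonnegative, so the mean of its average is its integral, which is small for a high
  level \<open>j\<close> uniformly in \<open>n\<close>.\<close>

theorem pos_part_average_L1:
  assumes g: "integrable P g"
  shows "(\<lambda>n. \<integral>x. max 0 (birkhoff_sum g n x / real n - (\<integral>x. g x \<partial>P)) \<partial>P) \<longlonglongrightarrow> 0"
proof -
  let ?m = "\<integral>x. g x \<partial>P"
  have [measurable]: "g \<in> borel_measurable P" using g by simp
  define t where "t = (\<lambda>j::nat. \<lambda>x. min (g x) (real j))"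
  have t_int: "integrable P (t j)" for j
    unfolding t_def using g by auto
  have t_lim: "(\<lambda>j. \<integral>x. t j x \<partial>P) \<longlonglongrightarrow> ?m"
  proof (rule integral_dominated_convergence[where w = "\<lambda>x. \<bar>g x\<bar>"])
    show "AE x in P. (\<lambda>j. t j x) \<longlonglongrightarrow> g x"
    proof (rule AE_I2)
      fix x
      obtain j0 :: nat where "g x < real j0" using reals_Archimedean2 by blast
      then have "\<forall>\<^sub>F j in sequentially. t j x = g x"
        unfolding t_def eventually_sequentially by (intro exI[of _ j0]) auto
      then show "(\<lambda>j. t j x) \<longlonglongrightarrow> g x" by (rule tendsto_eventually)
    qed
  qed (use g in \<open>auto simp: t_def\<close>)
  have bound: "(\<integral>x. max 0 (birkhoff_sum g n x / real n - ?m) \<partial>P)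
      \<le> (\<integral>x. max 0 (birkhoff_sum (t j) n x / real n - (\<integral>x. t j x \<partial>P)) \<partial>P) + (?m - (\<integral>x. t j x \<partial>P))" for n j
  proof -
    let ?u = "\<lambda>x. g x - t j x"
    have u_int: "integrable P ?u" using g t_int by auto
    have mono: "(\<integral>x. t j x \<partial>P) \<le> ?m"
      using g t_int by (intro integral_mono) (auto simp: t_def)
    have split: "birkhoff_sum g n x = birkhoff_sum (t j) n x + birkhoff_sum ?u n x" for x
      by (simp flip: birkhoff_sum_add)
    have u0: "0 \<le> birkhoff_sum ?u n x" for x by (rule birkhoff_sum_nonneg) (simp add: t_def)
    have "max 0 (birkhoff_sum g n x / real n - ?m)
        \<le> max 0 (birkhoff_sum (t j) n x / real n - (\<integral>x. t j x \<partial>P)) + birkhoff_sum ?u n x / real n" for x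
    proof -
      have "0 \<le> birkhoff_sum ?u n x / real n" using u0 by simp
      then show ?thesis unfolding split add_divide_distrib using mono by linarith
    qed
    then have "(\<integral>x. max 0 (birkhoff_sum g n x / real n - ?m) \<partial>P)
        \<le> (\<integral>x. max 0 (birkhoff_sum (t j) n x / real n - (\<integral>x. t j x \<partial>P)) + birkhoff_sum ?u n x / real n \<partial>P)"
      using integrable_birkhoff_sum[OF g, of n] integrable_birkhoff_sum[OF u_int, of n] integrable_birkhoff_sum[OF t_int, of j n]
      by (intro integral_mono Bochner_Integration.integrable_add integrable_max
          Bochner_Integration.integrable_diff integrable_divide_zero integrable_const) simp_all
    also have "\<dots> = (\<integral>x. max 0 (birkhoff_sum (t j) n x / real n - (\<integral>x. t j x \<partial>P)) \<partial>P)
        + (\<integral>x. birkhoff_sum ?u n x \<partial>P) / real n"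
      using integrable_birkhoff_sum[OF u_int, of n] integrable_birkhoff_sum[OF t_int, of j n] by simp
    \<comment> \<open>An equality except at \<open>n = 0\<close>, where the quotient is 0 by
      convention and \<open>mono\<close> is needed.\<close>
    also have "(\<integral>x. birkhoff_sum ?u n x \<partial>P) / real n \<le> ?m - (\<integral>x. t j x \<partial>P)"
      unfolding integral_birkhoff_sum[OF u_int] using mono g t_int by simp
    finally show ?thesis by simp
  qed
  show ?thesis
  proof (rule LIMSEQ_I)
    fix r :: real assume "0 < r"
    then have "\<forall>\<^sub>F j in sequentially. ?m - r / 2 < (\<integral>x. t j x \<partial>P)"
      by (intro order_tendstoD(1)[OF t_lim]) simp
    then obtain j where "?m - r / 2 < (\<integral>x. t j x \<partial>P)"
      using eventually_happens'[OF sequentially_bot] by blast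
    then have j: "?m - (\<integral>x. t j x \<partial>P) < r / 2" by simp
    have "(\<lambda>n. \<integral>x. max 0 (birkhoff_sum (t j) n x / real n - (\<integral>x. t j x \<partial>P)) \<partial>P) \<longlonglongrightarrow> 0"
      by (rule pos_part_average_L1_bounded[OF t_int, of _ "real j"]) (simp add: t_def)
    then obtain n0 where n0: "\<And>n. n \<ge> n0 \<Longrightarrow>
        \<bar>\<integral>x. max 0 (birkhoff_sum (t j) n x / real n - (\<integral>x. t j x \<partial>P)) \<partial>P\<bar> < r / 2"
      using LIMSEQ_D[OF _ half_gt_zero[OF \<open>0 < r\<close>]] by fastforce
    have "norm ((\<integral>x. max 0 (birkhoff_sum g n x / real n - ?m) \<partial>P) - 0) < r" if "n \<ge> n0" for n
    proof -
      have "0 \<le> (\<integral>x. max 0 (birkhoff_sum g n x / real n - ?m) \<partial>P)" by simp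
      then show ?thesis using bound[of n j] n0[OF that] j by simp
    qed
    then show "\<exists>no. \<forall>n\<ge>no. norm ((\<integral>x. max 0 (birkhoff_sum g n x / real n - ?m) \<partial>P) - 0) < r" by blast
  qed
qed

end

section \<open>Asymptotics of the entropy density\<close>

text \<open>The process is carried to its path space, where the passage of time is a map and the
  ergodic theorem above applies. Nothing is asked of \<open>f 0\<close>, hence the restrictions to
  \<open>n \<ge> 1\<close>.\<close>

locale ergodic_densities = ergodic_map P "\<lambda>x l. x (Suc l)"
  for P :: "(nat \<Rightarrow> real) measure" +
  fixes f :: "nat \<Rightarrow> vec \<Rightarrow> real" and h :: real
  assumes sets_P: "sets P = sets (\<Pi>\<^sub>M l\<in>UNIV. borel)"
    and density: "\<And>n. n \<ge> 1 \<Longrightarrow> distr P (euclid n) (window 0 n) = density (euclid n) (f n)"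
    and measurable_f: "\<And>n. n \<ge> 1 \<Longrightarrow> f n \<in> borel_measurable (euclid n)"
    and f_nonneg: "\<And>n w. n \<ge> 1 \<Longrightarrow> w \<in> space (euclid n) \<Longrightarrow> 0 \<le> f n w"
    and integrable_f: "\<And>n. n \<ge> 1 \<Longrightarrow> integrable (euclid n) (\<lambda>w. f n w * ln (f n w))"
    and entropy_rate: "(\<lambda>n. - (\<integral>w. f n w * ln (f n w) \<partial>euclid n) / real n) \<longlonglongrightarrow> h"
begin

definition block_entropy :: "nat \<Rightarrow> real" where
  "block_entropy n = - (\<integral>w. f n w * ln (f n w) \<partial>euclid n)"

definition log_density :: "nat \<Rightarrow> (nat \<Rightarrow> real) \<Rightarrow> real" where
  "log_density n x = ln (f n (window 0 n x))"

lemma measurable_window_P [measurable]: "window i m \<in> P \<rightarrow>\<^sub>M euclid m"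
  using measurable_window measurable_cong_sets[OF sets_P refl] by blast

lemma funpow_shift: "((\<lambda>x l. x (Suc l)) ^^ i) x = (\<lambda>l. (x :: nat \<Rightarrow> real) (i + l))"
  by (induction i arbitrary: x) (auto simp: funpow_swap1)

lemma distr_window: "n \<ge> 1 \<Longrightarrow> distr P (euclid n) (window i n) = density (euclid n) (f n)"
proof (induction i)
  case (Suc i)
  have "window (Suc i) n = window i n \<circ> (\<lambda>x l. x (Suc l))"
    by (auto simp: window_def fun_eq_iff)
  then have "distr P (euclid n) (window (Suc i) n) = distr (distr P P (\<lambda>x l. x (Suc l))) (euclid n) (window i n)"
    by (simp add: distr_distr)
  with Suc show ?case by (simp add: invariant)
qed (simp add: density)

text \<open>Every block of length \<open>n\<close> has density \<open>f n\<close>, so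
  \<open>P\<close> does not see what happens where \<open>f n\<close> vanishes.\<close>

lemma AE_window:
  assumes n: "n \<ge> 1" and ae: "AE w in euclid n. 0 < f n w \<longrightarrow> Q w"
  shows "AE x in P. Q (window i n x)"
proof -
  have "AE w in density (euclid n) (f n). Q w"
    using ae by (subst AE_density) (use measurable_f[OF n] in \<open>auto simp: ennreal_less_zero_iff\<close>)
  then have "AE w in distr P (euclid n) (window i n). Q w" unfolding distr_window[OF n] .
  then show ?thesis by (rule AE_distrD[OF measurable_window_P])
qed

lemma AE_f_pos: "n \<ge> 1 \<Longrightarrow> AE x in P. \<forall>i. 0 < f n (window i n x)"
  unfolding AE_all_countable by (intro allI AE_window) auto

lemma nn_integral_window:
  assumes n: "n \<ge> 1" and g: "g \<in> borel_measurable (euclid n)"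
  shows "(\<integral>\<^sup>+x. g (window 0 n x) \<partial>P) = (\<integral>\<^sup>+w. ennreal (f n w) * g w \<partial>euclid n)"
proof -
  have "(\<integral>\<^sup>+x. g (window 0 n x) \<partial>P) = (\<integral>\<^sup>+w. g w \<partial>distr P (euclid n) (window 0 n))"
    using g by (subst nn_integral_distr) auto
  also have "\<dots> = (\<integral>\<^sup>+w. ennreal (f n w) * g w \<partial>euclid n)"
    using g measurable_f[OF n] by (simp add: density[OF n] nn_integral_density)
  finally show ?thesis .
qed

lemma
  assumes n: "n \<ge> 1"
  shows integrable_log_density: "integrable P (log_density n)" and integral_log_density: "(\<integral>x. log_density n x \<partial>P) = - block_entropy n"
proof -
  have [measurable]: "f n \<in> borel_measurable (euclid n)" by (rule measurable_f[OF n])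
  have nn: "AE w in euclid n. 0 \<le> f n w" using f_nonneg[OF n] by auto
  have "integrable (density (euclid n) (f n)) (\<lambda>w. ln (f n w))"
    using integrable_f[OF n] nn by (subst integrable_real_density) auto
  then show "integrable P (log_density n)"
    unfolding log_density_def density[OF n, symmetric] by (subst (asm) integrable_distr_eq) auto
  have "(\<integral>x. log_density n x \<partial>P) = (\<integral>w. ln (f n w) \<partial>distr P (euclid n) (window 0 n))"
    unfolding log_density_def by (subst integral_distr) auto
  also have "\<dots> = - block_entropy n"
    unfolding density[OF n] block_entropy_def using nn by (subst integral_real_density) auto
  finally show "(\<integral>x. log_density n x \<partial>P) = - block_entropy n" .
qed

section \<open>Transition densities and Markov approximation\<close>

definition marg :: "nat \<Rightarrow> vec \<Rightarrow> ennreal" where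
  "marg k v = (\<integral>\<^sup>+y. ennreal (f (Suc k) (v(k := y))) \<partial>lborel)"

text \<open>The transition density is normalised by \<open>marg k\<close> and not by
  \<open>f k\<close>, which equals it only almost everywhere: thus its integral is at most 1 for
  every past. Where \<open>marg k\<close> is 0 or infinite, \<open>enn2real\<close> gives 0 and the
  quotient vanishes by convention.\<close>

definition cond :: "nat \<Rightarrow> vec \<Rightarrow> real" where
  "cond k w = f (Suc k) w / enn2real (marg k w)"

lemma measurable_marg: "marg k \<in> borel_measurable (euclid k)" "marg k \<in> borel_measurable (euclid (Suc k))"
proof -
  have eq: "(\<lambda>p. ennreal (f (Suc k) ((\<lambda>(v, y). v(k := y)) p))) = (\<lambda>(v, y). ennreal (f (Suc k) (v(k := y))))"
    by (auto simp: fun_eq_iff)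
  have "(\<lambda>(v, y). ennreal (f (Suc k) (v(k := y)))) \<in> borel_measurable (euclid k \<Otimes>\<^sub>M lborel)"
    "(\<lambda>(v, y). ennreal (f (Suc k) (v(k := y)))) \<in> borel_measurable (euclid (Suc k) \<Otimes>\<^sub>M lborel)"
    unfolding eq[symmetric]
    by (intro measurable_compose[OF measurable_compose[OF _ measurable_f] measurable_ennreal]
          measurable_euclid_upd, simp)+
  then show "marg k \<in> borel_measurable (euclid k)" "marg k \<in> borel_measurable (euclid (Suc k))"
    unfolding marg_def[abs_def] by (auto intro: lborel.borel_measurable_nn_integral)
qed

lemma measurable_cond: "cond k \<in> borel_measurable (euclid (Suc k))"
proof -
  note [measurable] = measurable_marg(2) measurable_f[of "Suc k", simplified]
  show ?thesis unfolding cond_def by measurable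
qed

lemma cond_nonneg: "w \<in> space (euclid (Suc k)) \<Longrightarrow> 0 \<le> cond k w"
  using f_nonneg[of "Suc k" w] by (simp add: cond_def)

lemma marg_upd: "marg k (v(k := y)) = marg k v"
  by (simp add: marg_def)

lemma nn_integral_cond_le_1:
  assumes v: "v \<in> space (euclid k)"
  shows "(\<integral>\<^sup>+y. ennreal (cond k (v(k := y))) \<partial>lborel) \<le> 1"
proof (cases "enn2real (marg k v) = 0")
  case True
  then show ?thesis by (simp add: cond_def marg_upd)
next
  case False
  define c where "c = enn2real (marg k v)"
  have c: "0 < c" using False by (simp add: c_def less_le)
  then have m: "marg k v = ennreal c"
    unfolding c_def by (cases "marg k v") auto
  have "v(k := y) \<in> space (euclid (Suc k))" for y
    using v by (auto simp: space_euclid extensional_def)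
  then have "ennreal (cond k (v(k := y))) = ennreal (f (Suc k) (v(k := y))) / ennreal c" for y
    using c f_nonneg[of "Suc k"] by (simp add: cond_def marg_upd c_def divide_ennreal)
  moreover have "(\<lambda>y. ennreal (f (Suc k) (v(k := y)))) \<in> borel_measurable lborel"
    by (intro measurable_compose[OF measurable_compose[OF measurable_euclid_upd'[OF v] measurable_f] measurable_ennreal]) simp
  ultimately have "(\<integral>\<^sup>+y. ennreal (cond k (v(k := y))) \<partial>lborel) = marg k v / ennreal c"
    by (simp add: marg_def nn_integral_divide)
  then show ?thesis using c m by (simp add: divide_ennreal)
qed

text \<open>Both functions are densities of the law of the first \<open>k\<close> coordinates, and
  densities with respect to a sigma-finite measure are unique almost everywhere. The two integrals
  meet under \<open>P\<close>, where the block of length \<open>k\<close> is cut out of the block of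
  length \<open>k + 1\<close>.\<close>

lemma AE_marg:
  assumes k: "k \<ge> 1"
  shows "AE v in euclid k. marg k v = ennreal (f k v)"
proof -
  note [measurable] = measurable_marg measurable_f[of "Suc k", simplified] measurable_f[OF k]
    measurable_window_euclid[of 0 k "Suc k", simplified]
  interpret sigma_finite_measure "euclid k" by (rule sigma_finite_euclid)
  have "density (euclid k) (marg k) = density (euclid k) (f k)"
  proof (rule measure_eqI)
    fix A assume "A \<in> sets (density (euclid k) (marg k))"
    then have A [measurable]: "A \<in> sets (euclid k)" by simp
    have "emeasure (density (euclid k) (marg k)) A = (\<integral>\<^sup>+v. marg k v * indicator A v \<partial>euclid k)"
      by (simp add: emeasure_density)
    also have "\<dots> = (\<integral>\<^sup>+v. (\<integral>\<^sup>+y. ennreal (f (Suc k) (v(k := y))) * indicator A (window 0 k (v(k := y))) \<partial>lborel) \<partial>euclid k)"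
    proof (rule nn_integral_cong)
      fix v assume v: "v \<in> space (euclid k)"
      have "(\<lambda>y. ennreal (f (Suc k) (v(k := y)))) \<in> borel_measurable lborel"
        by (intro measurable_compose[OF measurable_compose[OF measurable_euclid_upd'[OF v] measurable_f] measurable_ennreal]) simp
      then show "marg k v * indicator A v = (\<integral>\<^sup>+y. ennreal (f (Suc k) (v(k := y))) * indicator A (window 0 k (v(k := y))) \<partial>lborel)"
        by (simp add: marg_def nn_integral_multc window_upd window_self[OF v])
    qed
    also have "\<dots> = (\<integral>\<^sup>+w. ennreal (f (Suc k) w) * indicator A (window 0 k w) \<partial>euclid (Suc k))"
      by (rule nn_integral_euclid_Suc[symmetric]) measurable
    also have "\<dots> = (\<integral>\<^sup>+x. indicator A (window 0 k (window 0 (Suc k) x)) \<partial>P)"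
      by (rule nn_integral_window[symmetric]) simp_all
    also have "\<dots> = (\<integral>\<^sup>+w. ennreal (f k w) * indicator A w \<partial>euclid k)"
      using nn_integral_window[OF k, of "indicator A"] by (simp add: window_window)
    also have "\<dots> = emeasure (density (euclid k) (f k)) A" by (simp add: emeasure_density)
    finally show "emeasure (density (euclid k) (marg k)) A = emeasure (density (euclid k) (f k)) A" .
  qed simp
  then show ?thesis by (subst (asm) density_unique_iff) auto
qed

text \<open>Along almost every path this turns - ln \<open>cond\<close> at the window starting at
  \<open>i\<close> into the difference of two log densities composed with the \<open>i\<close>-th
  shift, that is, into a summand of a Birkhoff sum.\<close>

lemma AE_cond:
  assumes k: "k \<ge> 1"
  shows "AE x in P. \<forall>i. cond k (window i (Suc k) x) = f (Suc k) (window i (Suc k) x) / f k (window i k x)"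
proof -
  have "AE x in P. \<forall>i. marg k (window i k x) = ennreal (f k (window i k x))"
    unfolding AE_all_countable
  proof (intro allI AE_window[OF k])
    show "AE w in euclid k. 0 < f k w \<longrightarrow> marg k w = ennreal (f k w)" using AE_marg[OF k] by auto
  qed
  then show ?thesis
  proof eventually_elim
    case (elim x)
    have "marg k (window i (Suc k) x) = marg k (window i k x)" for i
      by (simp add: marg_def window_Suc_upd)
    then show ?case using elim f_nonneg[OF k] by (simp add: cond_def)
  qed
qed

text \<open>The density of the Markov chain of order \<open>k\<close> with the same transition densities.\<close>

definition markov_density :: "nat \<Rightarrow> nat \<Rightarrow> vec \<Rightarrow> real" where
  "markov_density k n w = f k (window 0 k w) * (\<Prod>i<n - k. cond k (window i (Suc k) w))"

lemma measurable_markov_density: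
  assumes k: "k \<ge> 1" and n: "k \<le> n"
  shows "markov_density k n \<in> borel_measurable (euclid n)"
proof -
  have "(\<lambda>w. cond k (window i (Suc k) w)) \<in> borel_measurable (euclid n)" if "i < n - k" for i
    using that by (intro measurable_compose[OF measurable_window_euclid measurable_cond]) simp
  moreover have "(\<lambda>w. f k (window 0 k w)) \<in> borel_measurable (euclid n)"
    using n by (intro measurable_compose[OF measurable_window_euclid measurable_f[OF k]]) simp
  ultimately show ?thesis unfolding markov_density_def by (intro borel_measurable_times borel_measurable_prod) auto
qed

lemma markov_density_nonneg: "k \<ge> 1 \<Longrightarrow> 0 \<le> markov_density k n w"
  unfolding markov_density_def by (intro mult_nonneg_nonneg prod_nonneg) (auto intro: f_nonneg cond_nonneg)

text \<open>The last coordinate occurs in the last factor only, whose integral over it is at most 1.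
  The integral can fall short of 1 because \<open>cond\<close> vanishes after exceptional
  pasts.\<close>

lemma nn_integral_markov_density_le_1:
  assumes k: "k \<ge> 1"
  shows "(\<integral>\<^sup>+w. ennreal (markov_density k (k + m) w) \<partial>euclid (k + m)) \<le> 1"
proof (induction m)
  case 0
  have "(\<integral>\<^sup>+w. ennreal (markov_density k k w) \<partial>euclid k) = (\<integral>\<^sup>+w. ennreal (f k w) * 1 \<partial>euclid k)"
    by (rule nn_integral_cong) (simp add: markov_density_def window_self)
  also have "\<dots> = (\<integral>\<^sup>+x. 1 \<partial>P)" by (rule nn_integral_window[OF k, symmetric]) simp
  finally show ?case by (simp add: emeasure_space_1)
next
  case (Suc m)
  have "(\<integral>\<^sup>+w. ennreal (markov_density k (k + Suc m) w) \<partial>euclid (k + Suc m))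
      = (\<integral>\<^sup>+v. (\<integral>\<^sup>+y. ennreal (markov_density k (k + Suc m) (v(k + m := y))) \<partial>lborel) \<partial>euclid (k + m))"
    using measurable_markov_density[OF k, of "k + Suc m"] nn_integral_euclid_Suc[of "\<lambda>w. ennreal (markov_density k (k + Suc m) w)" "k + m"]
    by simp
  also have "\<dots> \<le> (\<integral>\<^sup>+v. ennreal (markov_density k (k + m) v) \<partial>euclid (k + m))"
  proof (rule nn_integral_mono)
    fix v assume "v \<in> space (euclid (k + m))"
    have "markov_density k (k + Suc m) (v(k + m := y)) = markov_density k (k + m) v * cond k ((window m k v)(k := y))" for y
    proof -
      have "window m (Suc k) (v(k + m := y)) = (window m k v)(k := y)"
        using window_upd_last[of m k v y] by (simp add: add.commute)
      moreover have "(\<Prod>i<m. cond k (window i (Suc k) (v(k + m := y)))) = (\<Prod>i<m. cond k (window i (Suc k) v))"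
        by (intro prod.cong) (auto simp: window_upd)
      ultimately show ?thesis by (simp add: markov_density_def window_upd)
    qed
    then have "(\<integral>\<^sup>+y. ennreal (markov_density k (k + Suc m) (v(k + m := y))) \<partial>lborel)
        = (\<integral>\<^sup>+y. ennreal (markov_density k (k + m) v) * ennreal (cond k ((window m k v)(k := y))) \<partial>lborel)"
      by (simp add: ennreal_mult' markov_density_nonneg[OF k])
    also have "\<dots> = ennreal (markov_density k (k + m) v) * (\<integral>\<^sup>+y. ennreal (cond k ((window m k v)(k := y))) \<partial>lborel)"
      by (intro nn_integral_cmult measurable_compose[OF measurable_compose[OF measurable_euclid_upd'[OF window_in_space] measurable_cond] measurable_ennreal])
    also have "\<dots> \<le> ennreal (markov_density k (k + m) v)"
      using mult_left_mono[OF nn_integral_cond_le_1[OF window_in_space, of k m v], of "ennreal (markov_density k (k + m) v)"]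
      by simp
    finally show "(\<integral>\<^sup>+y. ennreal (markov_density k (k + Suc m) (v(k + m := y))) \<partial>lborel) \<le> ennreal (markov_density k (k + m) v)" .
  qed
  finally show ?case using Suc by simp
qed

text \<open>Integrating against the law multiplies by \<open>f n\<close>, which cancels the
  denominator; where \<open>f n\<close> is 0 the quotient is 0 too, so that some mass of the Markov
  density may be lost but none is gained.\<close>

lemma likelihood_ratio:
  assumes k: "k \<ge> 1" and n: "k \<le> n"
  shows "integrable P (\<lambda>x. markov_density k n (window 0 n x) / f n (window 0 n x))"
    and "(\<integral>x. markov_density k n (window 0 n x) / f n (window 0 n x) \<partial>P) \<le> 1"
proof -
  have n1: "n \<ge> 1" using k n by simp
  note [measurable] = measurable_markov_density[OF k n] measurable_f[OF n1]
  have "(\<integral>\<^sup>+x. ennreal (markov_density k n (window 0 n x) / f n (window 0 n x)) \<partial>P)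
      = (\<integral>\<^sup>+w. ennreal (f n w) * ennreal (markov_density k n w / f n w) \<partial>euclid n)"
    by (rule nn_integral_window[OF n1]) measurable
  also have "\<dots> \<le> (\<integral>\<^sup>+w. ennreal (markov_density k n w) \<partial>euclid n)"
    using f_nonneg[OF n1] markov_density_nonneg[OF k]
    by (intro nn_integral_mono) (auto simp flip: ennreal_mult' simp: ennreal_leI)
  also have "\<dots> \<le> 1" using nn_integral_markov_density_le_1[OF k, of "n - k"] n by simp
  finally have le: "(\<integral>\<^sup>+x. ennreal (markov_density k n (window 0 n x) / f n (window 0 n x)) \<partial>P) \<le> 1" .
  have nn: "0 \<le> markov_density k n (window 0 n x) / f n (window 0 n x)" for x
    using f_nonneg[OF n1] markov_density_nonneg[OF k] by simp
  show int: "integrable P (\<lambda>x. markov_density k n (window 0 n x) / f n (window 0 n x))"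
    by (rule integrableI_nonneg) (use nn le in \<open>auto intro: le_less_trans\<close>)
  show "(\<integral>x. markov_density k n (window 0 n x) / f n (window 0 n x) \<partial>P) \<le> 1"
    using le nn_integral_eq_integral[OF int] nn by simp
qed

text \<open>From ln z \<le> z - 1 at z = q / f, the number - ln f is at most - ln q + q / f, and -
  ln q is \<open>- log_density k x\<close> plus a Birkhoff sum of \<open>G\<close>. Centring that
  sum by \<open>g\<close> leaves a deterministic remainder, and each signed term is replaced by its
  absolute value or positive part. Here \<open>g\<close> is any real; it is later taken to be the
  mean of \<open>G\<close>.\<close>

lemma AE_pos_part_bound:
  assumes k: "k \<ge> 1" and n: "k \<le> n"
  defines "G \<equiv> \<lambda>x. log_density k x - log_density (Suc k) x"
  shows "AE x in P. max 0 (- log_density n x - real n * h) \<le> \<bar>log_density k x\<bar> + max 0 (birkhoff_sum G (n - k) x - real (n - k) * g)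
      + markov_density k n (window 0 n x) / f n (window 0 n x) + max 0 (real (n - k) * g - real n * h)"
proof -
  have n1: "n \<ge> 1" using k n by simp
  show ?thesis
    using AE_f_pos[OF n1] AE_f_pos[OF k] AE_f_pos[of "Suc k", simplified] AE_cond[OF k]
  proof eventually_elim
    case (elim x)
    let ?q = "markov_density k n (window 0 n x)" and ?f = "f n (window 0 n x)"
    have cpos: "0 < cond k (window i (Suc k) x)" for i using elim by simp
    have "?q = f k (window 0 k x) * (\<Prod>i<n - k. cond k (window i (Suc k) x))"
      unfolding markov_density_def using n by (simp add: window_window)
    moreover have "0 < f k (window 0 k x)" "0 < (\<Prod>i<n - k. cond k (window i (Suc k) x))"
      using elim cpos by (auto intro: prod_pos)
    moreover have "ln (\<Prod>i<n - k. cond k (window i (Suc k) x)) = (\<Sum>i<n - k. ln (cond k (window i (Suc k) x)))"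
      using cpos by (intro ln_prod) (auto simp: less_imp_neq[THEN not_sym])
    ultimately have qpos: "0 < ?q" and "ln ?q = log_density k x + (\<Sum>i<n - k. ln (cond k (window i (Suc k) x)))"
      by (simp_all only: ln_mult_pos log_density_def mult_pos_pos)
    note this(2)
    moreover have "ln (cond k (window i (Suc k) x)) = - G (((\<lambda>x l. x (Suc l)) ^^ i) x)" for i
    proof -
      have "window 0 m (\<lambda>l. x (i + l)) = window i m x" for m by (auto simp: window_def)
      moreover have "f k (window i k x) \<noteq> 0" "f (Suc k) (window i (Suc k) x) \<noteq> 0"
        using spec[OF elim(2), of i] spec[OF elim(3), of i] by auto
      ultimately show ?thesis using elim by (simp add: G_def log_density_def funpow_shift ln_div)
    qed
    ultimately have "ln ?q = log_density k x - birkhoff_sum G (n - k) x"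
      by (simp add: birkhoff_sum_funpow sum_negf)
    moreover have fpos: "0 < ?f" using spec[OF elim(1), of 0] .
    moreover have "ln ?q - log_density n x \<le> ?q / ?f"
      using qpos fpos ln_le_minus_one[of "?q / ?f"] unfolding log_density_def by (subst ln_divide_pos[symmetric]) auto
    moreover have "0 \<le> ?q / ?f" using qpos fpos by simp
    ultimately show ?case by linarith
  qed
qed

text \<open>Otherwise the block entropies would grow at least linearly with slope
  \<open>h + e\<close>, against the rate \<open>h\<close>.\<close>

lemma exists_small_increment:
  assumes "0 < e"
  shows "\<exists>k\<ge>1. block_entropy (Suc k) - block_entropy k \<le> h + e"
proof (rule ccontr)
  assume "\<not> ?thesis"
  then have inc: "h + e < block_entropy (Suc k) - block_entropy k" if "k \<ge> 1" for k using that by auto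
  have ge: "block_entropy 1 + real n * (h + e) \<le> block_entropy (Suc n)" for n
  proof (induction n)
    case (Suc n)
    then show ?case using inc[of "Suc n"] by (simp add: algebra_simps)
  qed simp
  have "(\<lambda>n. (h + e) + (block_entropy 1 - (h + e)) / real (Suc n)) \<longlonglongrightarrow> (h + e) + 0"
    by (intro tendsto_add tendsto_const LIMSEQ_Suc lim_const_over_n)
  moreover have "(h + e) + (block_entropy 1 - (h + e)) / real (Suc n) = (block_entropy 1 + real n * (h + e)) / real (Suc n)" for n
    by (simp add: field_simps)
  ultimately have "(\<lambda>n. (block_entropy 1 + real n * (h + e)) / real (Suc n)) \<longlonglongrightarrow> h + e" by simp
  moreover have "(\<lambda>n. block_entropy (Suc n) / real (Suc n)) \<longlonglongrightarrow> h"
    using LIMSEQ_Suc[OF entropy_rate] by (simp add: block_entropy_def)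
  ultimately have "h + e \<le> h"
    by (rule LIMSEQ_le) (use ge in \<open>auto intro!: divide_right_mono\<close>)
  then show False using assms by simp
qed

text \<open>The order \<open>k\<close> is fixed before \<open>n\<close> grows. After division by
  \<open>n\<close> the initial block and the likelihood ratio leave only (b + 1) / n, the ergodic
  theorem removes the fluctuation of the Birkhoff sum, and what survives is the positive part of
  \<open>g - h\<close>, at most \<open>e / 2\<close> by the choice of \<open>k\<close>.\<close>

lemma pos_part_entropy_L1:
  assumes e: "0 < e"
  shows "\<forall>\<^sub>F n in sequentially. (\<integral>x. max 0 (- log_density n x - real n * h) \<partial>P) / real n < e"
proof -
  obtain k where k: "k \<ge> 1" and inc: "block_entropy (Suc k) - block_entropy k \<le> h + e / 2"
    using exists_small_increment[of "e / 2"] e by auto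
  define G where "G = (\<lambda>x. log_density k x - log_density (Suc k) x)"
  define g where "g = (\<integral>x. G x \<partial>P)"
  define a where "a = (\<lambda>m. \<integral>x. max 0 (birkhoff_sum G m x / real m - g) \<partial>P)"
  define b where "b = (\<integral>x. \<bar>log_density k x\<bar> \<partial>P)"
  have G: "integrable P G" unfolding G_def using k by (simp add: integrable_log_density)
  have g: "g \<le> h + e / 2"
    using inc k by (simp add: g_def G_def integrable_log_density integral_log_density)
  have bound: "(\<integral>x. max 0 (- log_density n x - real n * h) \<partial>P) / real n
      \<le> (b + 1) / real n + a (n - k) + max 0 (real (n - k) * g - real n * h) / real n" if n: "k \<le> n" for n
  proof -
    have n1: "n \<ge> 1" using n k by simp
    have int_G: "integrable P (\<lambda>x. max 0 (birkhoff_sum G (n - k) x - real (n - k) * g))"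
      using integrable_birkhoff_sum[OF G, of "n - k"] by simp
    have "max 0 (birkhoff_sum G m x - real m * g) = real m * max 0 (birkhoff_sum G m x / real m - g)" for m x
      by (cases "m = 0") (auto simp: max_mult_distrib_left right_diff_distrib)
    then have ea: "(\<integral>x. max 0 (birkhoff_sum G (n - k) x - real (n - k) * g) \<partial>P) = real (n - k) * a (n - k)"
      by (simp add: a_def)
    have "(\<integral>x. max 0 (- log_density n x - real n * h) \<partial>P) \<le> (\<integral>x. \<bar>log_density k x\<bar> + max 0 (birkhoff_sum G (n - k) x - real (n - k) * g)
      + markov_density k n (window 0 n x) / f n (window 0 n x) + max 0 (real (n - k) * g - real n * h) \<partial>P)"
      using AE_pos_part_bound[OF k n, of g] integrable_log_density[OF n1] integrable_log_density[OF k] integrable_birkhoff_sum[OF G, of "n - k"]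
        likelihood_ratio(1)[OF k n]
      unfolding G_def
      by (intro integral_mono_AE Bochner_Integration.integrable_add integrable_abs integrable_const
         integrable_max Bochner_Integration.integrable_diff) auto
    also have "\<dots> = b + real (n - k) * a (n - k) + (\<integral>x. markov_density k n (window 0 n x) / f n (window 0 n x) \<partial>P) + max 0 (real (n - k) * g - real n * h)"
      using integrable_log_density[OF k] int_G likelihood_ratio(1)[OF k n] by (simp add: b_def ea prob_space)
    also have "\<dots> \<le> b + real n * a (n - k) + 1 + max 0 (real (n - k) * g - real n * h)"
    proof -
      have "0 \<le> a (n - k)" by (simp add: a_def)
      then have "real (n - k) * a (n - k) \<le> real n * a (n - k)" by (intro mult_right_mono) auto
      then show ?thesis using likelihood_ratio(2)[OF k n] by simp
    qed
    finally have "(\<integral>x. max 0 (- log_density n x - real n * h) \<partial>P) / real n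
        \<le> (b + real n * a (n - k) + 1 + max 0 (real (n - k) * g - real n * h)) / real n"
      by (rule divide_right_mono) simp
    also have "\<dots> = (b + 1) / real n + a (n - k) + max 0 (real (n - k) * g - real n * h) / real n"
      using n1 by (simp add: add_divide_distrib)
    finally show ?thesis .
  qed
  have "(\<lambda>n. (b + 1) / real n + a (n - k) + max 0 (real (n - k) * g - real n * h) / real n)
      \<longlonglongrightarrow> 0 + 0 + max 0 (g - h)"
  proof (intro tendsto_add)
    show "(\<lambda>n. (b + 1) / real n) \<longlonglongrightarrow> 0" by (rule lim_const_over_n)
    show "(\<lambda>n. a (n - k)) \<longlonglongrightarrow> 0"
      using pos_part_average_L1[OF G] unfolding a_def g_def
      by (rule filterlim_compose) (rule filterlim_minus_const_nat_at_top)
    have "(\<lambda>n. max 0 ((1 - real k / real n) * g - h)) \<longlonglongrightarrow> max 0 ((1 - 0) * g - h)"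
      by (intro tendsto_max tendsto_diff tendsto_mult tendsto_const lim_const_over_n)
    then have lim: "(\<lambda>n. max 0 ((1 - real k / real n) * g - h)) \<longlonglongrightarrow> max 0 (g - h)" by simp
    have "\<forall>\<^sub>F n in sequentially. max 0 ((1 - real k / real n) * g - h) = max 0 (real (n - k) * g - real n * h) / real n"
      using eventually_ge_at_top[of k]
    proof eventually_elim
      case (elim n)
      have "(1 - real k / real n) * g - h = (real (n - k) * g - real n * h) / real n"
        using elim k by (simp add: of_nat_diff field_simps)
      then show ?case by (auto simp: max_def divide_nonneg_nonneg divide_less_0_iff zero_le_divide_iff)
    qed
    then show "(\<lambda>n. max 0 (real (n - k) * g - real n * h) / real n) \<longlonglongrightarrow> max 0 (g - h)"
      by (rule Lim_transform_eventually[OF lim])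
  qed
  moreover have "0 + 0 + max 0 (g - h) < e" using g e by simp
  ultimately have "\<forall>\<^sub>F n in sequentially. (b + 1) / real n + a (n - k) + max 0 (real (n - k) * g - real n * h) / real n < e"
    using order_tendstoD(2) by blast
  then show ?thesis
    using eventually_ge_at_top[of k]
  proof eventually_elim
    case (elim n)
    then show ?case using bound[of n] by linarith
  qed
qed

text \<open>A negative part is the positive part minus the variable, and the mean of the variable,
  divided by \<open>n\<close>, tends to 0 by the definition of the rate.\<close>

lemma neg_part_entropy_L1:
  assumes e: "0 < e"
  shows "\<forall>\<^sub>F n in sequentially. (\<integral>x. max 0 (log_density n x + real n * h) \<partial>P) / real n < e"
proof -
  have "\<forall>\<^sub>F n in sequentially. h - e / 2 < block_entropy n / real n"
    using order_tendstoD(1)[OF entropy_rate, of "h - e / 2"] e by (simp add: block_entropy_def)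
  then show ?thesis
    using pos_part_entropy_L1[of "e / 2", OF half_gt_zero[OF e]] eventually_ge_at_top[of 1]
  proof eventually_elim
    case (elim n)
    have int: "integrable P (log_density n)" by (rule integrable_log_density) fact
    have "(\<integral>x. max 0 (log_density n x + real n * h) \<partial>P)
        = (\<integral>x. max 0 (- log_density n x - real n * h) + (log_density n x + real n * h) \<partial>P)"
      by (intro Bochner_Integration.integral_cong) (auto simp: max_def)
    also have "\<dots> = (\<integral>x. max 0 (- log_density n x - real n * h) \<partial>P) + (- block_entropy n + real n * h)"
      using int integral_log_density[of n] elim by (simp add: prob_space)
    finally have "(\<integral>x. max 0 (log_density n x + real n * h) \<partial>P) / real n
        = (\<integral>x. max 0 (- log_density n x - real n * h) \<partial>P) / real n + (h - block_entropy n / real n)"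
      using elim by (simp add: add_divide_distrib diff_divide_distrib)
    with elim show ?case by linarith
  qed
qed

text \<open>Exceeding the threshold means that \<open>log_density n x + real n * h\<close> is larger
  than \<open>real n * d\<close>, so Markov's inequality applies to the negative part just
  estimated.\<close>

theorem density_concentration:
  assumes d: "0 < d"
  shows "(\<lambda>n. measure (density (euclid n) (f n)) {w \<in> space (euclid n). exp (- (real n * (h - d))) < f n w}) \<longlonglongrightarrow> 0"
proof -
  have le: "measure (density (euclid n) (f n)) {w \<in> space (euclid n). exp (- (real n * (h - d))) < f n w}
      \<le> (\<integral>x. max 0 (log_density n x + real n * h) \<partial>P) / real n / d" if n: "n \<ge> 1" for n
  proof -
    note [measurable] = measurable_f[OF n]
    have [measurable]: "log_density n \<in> borel_measurable P" using integrable_log_density[OF n] by simp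
    let ?B = "{w \<in> space (euclid n). exp (- (real n * (h - d))) < f n w}"
    have "measure (density (euclid n) (f n)) ?B = measure P (window 0 n -` ?B \<inter> space P)"
      unfolding density[OF n, symmetric] by (subst measure_distr) auto
    also have "\<dots> \<le> measure P {x \<in> space P. real n * d \<le> max 0 (log_density n x + real n * h)}"
    proof (rule finite_measure_mono)
      show "window 0 n -` ?B \<inter> space P \<subseteq> {x \<in> space P. real n * d \<le> max 0 (log_density n x + real n * h)}"
      proof safe
        fix x assume "exp (- (real n * (h - d))) < f n (window 0 n x)"
        then have "- (real n * (h - d)) < log_density n x"
          unfolding log_density_def using ln_less_cancel_iff[of "exp (- (real n * (h - d)))" "f n (window 0 n x)"]
            less_trans[OF exp_gt_zero] by simp
        then show "real n * d \<le> max 0 (log_density n x + real n * h)" by (simp add: algebra_simps)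
      qed
    qed measurable
    also have "\<dots> \<le> (\<integral>x. max 0 (log_density n x + real n * h) \<partial>P) / (real n * d)"
      by (rule integral_Markov_inequality_measure[where A = "{}"])
        (use integrable_log_density[OF n] n d in auto)
    finally show ?thesis by simp
  qed
  show ?thesis
  proof (rule LIMSEQ_I)
    fix e :: real assume e: "0 < e"
    have "\<forall>\<^sub>F n in sequentially. norm (measure (density (euclid n) (f n)) {w \<in> space (euclid n). exp (- (real n * (h - d))) < f n w} - 0) < e"
      using neg_part_entropy_L1[of "e * d", OF mult_pos_pos[OF e d]] eventually_ge_at_top[of 1]
    proof eventually_elim
      case (elim n)
      then have "(\<integral>x. max 0 (log_density n x + real n * h) \<partial>P) / real n / d < e"
        using d by (simp add: pos_divide_less_eq mult_ac)
      then show ?case using le[of n] elim by (simp add: measure_nonneg)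
    qed
    then show "\<exists>no. \<forall>n\<ge>no. norm (measure (density (euclid n) (f n)) {w \<in> space (euclid n). exp (- (real n * (h - d))) < f n w} - 0) < e"
      by (simp add: eventually_sequentially)
  qed
qed

end

section \<open>Translations and random open sets\<close>

lemma topspace_euclid_top: "topspace (euclid_top n) = space (euclid n)"
  by (simp add: euclid_top_def space_euclid PiE_def)

lemma vshift_in_space [simp]: "vshift n x y \<in> space (euclid n)"
  by (simp add: vshift_def space_euclid)

lemma vneg_in_space [simp]: "vneg n x \<in> space (euclid n)"
  by (simp add: vneg_def space_euclid)

lemma vshift_vneg [simp]: "y \<in> space (euclid n) \<Longrightarrow> vshift n x (vshift n (vneg n x) y) = y"
  "y \<in> space (euclid n) \<Longrightarrow> vshift n (vneg n x) (vshift n x y) = y"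
  by (auto simp: vshift_def vneg_def space_euclid fun_eq_iff extensional_def)

lemma vshift_image_iff:
  assumes "U \<subseteq> space (euclid n)" "y \<in> space (euclid n)"
  shows "y \<in> vshift n x ` U \<longleftrightarrow> vshift n (vneg n x) y \<in> U"
  using assms by (force intro: rev_image_eqI)

lemma vshift_vneg_image_iff:
  assumes "U \<subseteq> space (euclid n)" "y \<in> space (euclid n)"
  shows "y \<in> vshift n (vneg n x) ` U \<longleftrightarrow> vshift n x y \<in> U"
  using assms by (force intro: rev_image_eqI)

text \<open>The pivot of the mass transport: translating by the test point itself turns a question
  about that point into one about the origin.\<close>

lemma vshift_self_image_iff:
  assumes "U \<subseteq> space (euclid n)" and y: "y \<in> space (euclid n)"
  shows "y \<in> vshift n y ` U \<longleftrightarrow> vorigin n \<in> U"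
proof -
  have "vshift n (vneg n y) y = vorigin n"
    by (auto simp: vshift_def vneg_def vorigin_def)
  then show ?thesis using vshift_image_iff[OF assms, of y] by simp
qed

lemma measurable_vshift2 [measurable]:
  "(\<lambda>(x, y). vshift n x y) \<in> euclid n \<Otimes>\<^sub>M euclid n \<rightarrow>\<^sub>M euclid n"
proof (rule measurable_euclidI)
  fix j assume j: "j < n"
  have [measurable]: "(\<lambda>w. w j) \<in> borel_measurable (euclid n)"
    by (rule measurable_euclid_component[OF j])
  show "(\<lambda>p. (case p of (x, y) \<Rightarrow> vshift n x y) j) \<in> borel_measurable (euclid n \<Otimes>\<^sub>M euclid n)"
    using j by (simp add: vshift_def case_prod_beta)
qed (auto simp: vshift_def)

lemma measurable_vshift [measurable]: "vshift n x \<in> euclid n \<rightarrow>\<^sub>M euclid n"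
proof (rule measurable_euclidI)
  fix j assume j: "j < n"
  have [measurable]: "(\<lambda>w. w j) \<in> borel_measurable (euclid n)"
    by (rule measurable_euclid_component[OF j])
  show "(\<lambda>y. vshift n x y j) \<in> borel_measurable (euclid n)"
    using j by (simp add: vshift_def)
qed (auto simp: vshift_def)

lemma distr_vshift: "distr (euclid n) (euclid n) (vshift n x) = euclid n"
proof -
  interpret product_sigma_finite "\<lambda>_::nat. lborel :: real measure" ..
  have "distr (euclid n) (euclid n) (vshift n x) = PiM {..<n} (\<lambda>_. lborel)"
  proof (rule PiM_eqI)
    fix A :: "nat \<Rightarrow> real set" assume A: "\<And>i. i \<in> {..<n} \<Longrightarrow> A i \<in> sets lborel"
    have m: "(+) (x i) -` A i \<in> sets lborel" if "i < n" for i
      using measurable_sets[of "(+) (x i)" borel borel "A i"] A[of i] that by simp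
    have "vshift n x -` (Pi\<^sub>E {..<n} A) \<inter> space (euclid n) = (\<Pi>\<^sub>E i\<in>{..<n}. (+) (x i) -` A i)"
      by (auto simp: vshift_def space_euclid PiE_def Pi_def add.commute)
    then have "emeasure (distr (euclid n) (euclid n) (vshift n x)) (Pi\<^sub>E {..<n} A)
        = emeasure (euclid n) (\<Pi>\<^sub>E i\<in>{..<n}. (+) (x i) -` A i)"
      using A by (subst emeasure_distr) (use measurable_vshift[of n x] in \<open>auto simp: euclid_def intro!: sets_PiM_I_finite\<close>)
    also have "\<dots> = (\<Prod>i<n. emeasure lborel ((+) (x i) -` A i))"
      unfolding euclid_def using m by (subst emeasure_PiM) auto
    also have "\<dots> = (\<Prod>i<n. emeasure lborel (A i))"
    proof (rule prod.cong)
      fix i assume "i \<in> {..<n}"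
      then have "emeasure (distr lborel borel ((+) (x i))) (A i) = emeasure lborel ((+) (x i) -` A i)"
        using A by (subst emeasure_distr) auto
      then show "emeasure lborel ((+) (x i) -` A i) = emeasure lborel (A i)"
        by (simp add: lborel_distr_plus)
    qed simp
    finally show "emeasure (distr (euclid n) (euclid n) (vshift n x)) (Pi\<^sub>E {..<n} A)
        = (\<Prod>i<n. emeasure lborel (A i))" .
  qed (auto simp: euclid_def)
  then show ?thesis by (simp add: euclid_def)
qed

lemma sets_unit_cube [measurable]: "unit_cube n \<in> sets (euclid n)"
  unfolding unit_cube_def euclid_def by (rule sets_PiM_I_finite) auto

lemma emeasure_unit_cube: "emeasure (euclid n) (unit_cube n) = 1"
proof -
  interpret product_sigma_finite "\<lambda>_::nat. lborel :: real measure" ..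
  show ?thesis unfolding unit_cube_def euclid_def by (subst emeasure_PiM) auto
qed

lemma continuous_map_vshift: "continuous_map (euclid_top n) (euclid_top n) (vshift n x)"
  unfolding euclid_top_def continuous_map_componentwise
  by (auto simp: vshift_def intro!: continuous_intros)

lemma openin_euclid_subset: "openin (euclid_top n) U \<Longrightarrow> U \<subseteq> space (euclid n)"
  using openin_subset topspace_euclid_top by blast

lemma openin_vshift_image:
  assumes U: "openin (euclid_top n) U"
  shows "openin (euclid_top n) (vshift n x ` U)"
proof -
  have "vshift n x ` U = {y \<in> topspace (euclid_top n). vshift n (vneg n x) y \<in> U}"
    using vshift_image_iff[OF openin_euclid_subset[OF U], of _ x] openin_euclid_subset[OF U]
    by (auto simp: topspace_euclid_top subset_iff)
  then show ?thesis
    using openin_continuous_map_preimage[OF continuous_map_vshift U] by simp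
qed

section \<open>Measurability of random regions\<close>

lemma space_region_space: "space (region_space n) = {U. openin (euclid_top n) U}"
  unfolding region_space_def by (rule space_measure_of) auto

lemma sets_region_space_superset:
  "compactin (euclid_top n) K \<Longrightarrow> {U. openin (euclid_top n) U \<and> K \<subseteq> U} \<in> sets (region_space n)"
  unfolding region_space_def by (subst sets_measure_of) auto

text \<open>Translations permute the generating events: U + x contains K exactly when U contains the
  compact set K - x.\<close>

lemma measurable_vshift_image [measurable]: "(`) (vshift n x) \<in> region_space n \<rightarrow>\<^sub>M region_space n"
  unfolding region_space_def[of n]
proof (rule measurable_measure_of)
  fix A assume "A \<in> {{U. openin (euclid_top n) U \<and> K \<subseteq> U} |K. compactin (euclid_top n) K}"
  then obtain K where K: "compactin (euclid_top n) K" and A: "A = {U. openin (euclid_top n) U \<and> K \<subseteq> U}"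
    by blast
  let ?K = "vshift n (vneg n x) ` K"
  have Ksub: "K \<subseteq> space (euclid n)" using compactin_subset_topspace[OF K] topspace_euclid_top by blast
  have "(`) (vshift n x) -` A \<inter> space (region_space n) = {U. openin (euclid_top n) U \<and> ?K \<subseteq> U}"
  proof -
    have "K \<subseteq> vshift n x ` U \<longleftrightarrow> ?K \<subseteq> U" if "openin (euclid_top n) U" for U
      using vshift_image_iff[OF openin_euclid_subset[OF that]] Ksub by blast
    then show ?thesis by (auto simp: A space_region_space openin_vshift_image)
  qed
  moreover have "compactin (euclid_top n) ?K" by (rule image_compactin[OF K continuous_map_vshift])
  ultimately show "(`) (vshift n x) -` A \<inter> space (sigma {U. openin (euclid_top n) U}
      {{U. openin (euclid_top n) U \<and> K \<subseteq> U} |K. compactin (euclid_top n) K})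
     \<in> sets (sigma {U. openin (euclid_top n) U}
      {{U. openin (euclid_top n) U \<and> K \<subseteq> U} |K. compactin (euclid_top n) K})"
    using sets_region_space_superset unfolding region_space_def by simp
qed (auto simp flip: region_space_def simp: space_region_space openin_vshift_image)

text \<open>Rational boxes are compact and countably many. They allow membership of a point in an
  open set to be tested by countably many of the generating events of \<open>region_space\<close>,
  which speak of compact subsets only.\<close>

lemma open_contains_rational_box:
  assumes U: "openin (euclid_top n) U" and d: "d \<in> U"
  shows "\<exists>a\<in>{..<n} \<rightarrow>\<^sub>E \<rat>. \<exists>b\<in>{..<n} \<rightarrow>\<^sub>E \<rat>. d \<in> (\<Pi>\<^sub>E i\<in>{..<n}. {a i..b i}) \<and> (\<Pi>\<^sub>E i\<in>{..<n}. {a i..b i}) \<subseteq> U"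
proof -
  obtain V where V: "\<forall>i<n. open (V i)" "d \<in> Pi\<^sub>E {..<n} V" "Pi\<^sub>E {..<n} V \<subseteq> U"
    using U[unfolded euclid_top_def openin_product_topology_alt, THEN bspec, OF d] by auto
  have "\<exists>pq. fst pq \<in> \<rat> \<and> snd pq \<in> \<rat> \<and> d i \<in> {fst pq..snd pq} \<and> {fst pq..snd pq} \<subseteq> V i" if i: "i < n" for i
  proof -
    have "open (V i)" "d i \<in> V i" using V i by auto
    then obtain e where e: "e > 0" "\<And>y. \<bar>y - d i\<bar> < e \<Longrightarrow> y \<in> V i"
      unfolding open_dist dist_real_def by blast
    obtain p where p: "p \<in> \<rat>" "d i - e < p" "p < d i" using Rats_dense_in_real[of "d i - e" "d i"] e by auto
    obtain q where q: "q \<in> \<rat>" "d i < q" "q < d i + e" using Rats_dense_in_real[of "d i" "d i + e"] e by auto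
    have "{p..q} \<subseteq> V i" using p q by (auto intro!: e(2))
    with p q show ?thesis by (intro exI[of _ "(p, q)"]) auto
  qed
  then obtain ab where *: "\<forall>i\<in>{..<n}. fst (ab i) \<in> \<rat> \<and> snd (ab i) \<in> \<rat> \<and> d i \<in> {fst (ab i)..snd (ab i)}
      \<and> {fst (ab i)..snd (ab i)} \<subseteq> V i"
    using bchoice[of "{..<n}" "\<lambda>i pq. fst pq \<in> \<rat> \<and> snd pq \<in> \<rat> \<and> d i \<in> {fst pq..snd pq} \<and> {fst pq..snd pq} \<subseteq> V i"]
    by blast
  define a b where "a = (\<lambda>i. fst (ab i))" and "b = (\<lambda>i. snd (ab i))"
  have ab: "a i \<in> \<rat> \<and> b i \<in> \<rat> \<and> d i \<in> {a i..b i} \<and> {a i..b i} \<subseteq> V i" if "i < n" for i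
    using * that unfolding a_def b_def by blast
  have "(\<Pi>\<^sub>E i\<in>{..<n}. {a i..b i}) \<subseteq> U"
    using PiE_mono[of "{..<n}" "\<lambda>i. {a i..b i}" V] ab V(3) by (meson lessThan_iff order_trans)
  moreover have "d \<in> (\<Pi>\<^sub>E i\<in>{..<n}. {a i..b i})" using ab V(2) by (auto simp: PiE_def)
  \<comment> \<open>Restricting the endpoints places them in a countable set of extensional
    functions and does not change the box.\<close>
  moreover have "(\<Pi>\<^sub>E i\<in>{..<n}. {restrict a {..<n} i..restrict b {..<n} i}) = (\<Pi>\<^sub>E i\<in>{..<n}. {a i..b i})"
    by (rule PiE_cong) auto
  ultimately show ?thesis
    using ab by (intro bexI[of _ "restrict a {..<n}"] bexI[of _ "restrict b {..<n}"]) auto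
qed

text \<open>The relation is a countable union of rectangles, one for each rational box: the points
  of the box times the open sets that contain it.\<close>

lemma sets_membership: "{p \<in> space (points_regions n). fst p \<in> snd p} \<in> sets (points_regions n)"
proof -
  define I :: "vec set" where "I = {..<n} \<rightarrow>\<^sub>E \<rat>"
  let ?box = "\<lambda>(a, b). \<Pi>\<^sub>E i\<in>{..<n}. {a i..(b i :: real)}"
  have "countable I" unfolding I_def by (intro countable_PiE) (auto simp: countable_rat)
  then have cnt: "countable (I \<times> I)" by simp
  have "{p \<in> space (points_regions n). fst p \<in> snd p}
      = (\<Union>ab\<in>I \<times> I. ?box ab \<times> {U. openin (euclid_top n) U \<and> ?box ab \<subseteq> U})"
  proof (intro equalityI subsetI)
    fix p assume "p \<in> {p \<in> space (points_regions n). fst p \<in> snd p}"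
    then have p: "openin (euclid_top n) (snd p)" "fst p \<in> snd p"
      by (auto simp: space_pair_measure space_region_space)
    obtain a b where "a \<in> I" "b \<in> I" "fst p \<in> ?box (a, b)" "?box (a, b) \<subseteq> snd p"
      using open_contains_rational_box[OF p] unfolding I_def by auto
    then show "p \<in> (\<Union>ab\<in>I \<times> I. ?box ab \<times> {U. openin (euclid_top n) U \<and> ?box ab \<subseteq> U})"
      using p by (intro UN_I[of "(a, b)"]) (simp_all add: mem_Times_iff)
  next
    fix p assume "p \<in> (\<Union>ab\<in>I \<times> I. ?box ab \<times> {U. openin (euclid_top n) U \<and> ?box ab \<subseteq> U})"
    then show "p \<in> {p \<in> space (points_regions n). fst p \<in> snd p}"
      using openin_euclid_subset[of n "snd p"]
      by (auto simp: space_pair_measure space_region_space mem_Times_iff)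
  qed
  also have "\<dots> \<in> sets (points_regions n)"
  proof (rule sets.countable_UN''[OF cnt])
    fix ab assume "ab \<in> I \<times> I"
    have "compactin (euclid_top n) (?box ab)"
      unfolding euclid_top_def by (cases ab) (auto simp: compactin_PiE)
    moreover have "?box ab \<in> sets (euclid n)"
      unfolding euclid_def by (cases ab) (auto intro!: sets_PiM_I_finite)
    ultimately show "?box ab \<times> {U. openin (euclid_top n) U \<and> ?box ab \<subseteq> U} \<in> sets (points_regions n)"
      by (intro pair_measureI sets_region_space_superset)
  qed
  finally show ?thesis .
qed

lemma measurable_membership [measurable (raw)]:
  assumes "u \<in> K \<rightarrow>\<^sub>M euclid n" "V \<in> K \<rightarrow>\<^sub>M region_space n"
  shows "Measurable.pred K (\<lambda>x. u x \<in> V x)"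
proof -
  have "(\<lambda>x. (u x, V x)) \<in> K \<rightarrow>\<^sub>M points_regions n" using assms by measurable
  then have "(\<lambda>x. (u x, V x)) -` {p \<in> space (points_regions n). fst p \<in> snd p} \<inter> space K \<in> sets K"
    by (rule measurable_sets[OF _ sets_membership])
  also have "(\<lambda>x. (u x, V x)) -` {p \<in> space (points_regions n). fst p \<in> snd p} \<inter> space K = {x \<in> space K. u x \<in> V x}"
    using measurable_space[OF assms(1)] measurable_space[OF assms(2)] by (auto simp: space_pair_measure)
  finally show ?thesis by (simp add: pred_def)
qed

lemma sets_region:
  assumes "openin (euclid_top n) U"
  shows "U \<in> sets (euclid n)"
proof -
  have "Measurable.pred (euclid n) (\<lambda>y. y \<in> U)"
    using assms measurable_membership[of "\<lambda>y. y" "euclid n" n "\<lambda>_. U"] by (simp add: space_region_space)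
  moreover have "{y \<in> space (euclid n). y \<in> U} = U" using openin_euclid_subset[OF assms] by auto
  ultimately show ?thesis by (simp add: pred_def)
qed

section \<open>Counting measures\<close>

lemma space_counting_algebra:
  "space (counting_algebra n S pos) =
     {\<nu>. sets \<nu> = sets S \<and>
         (\<forall>B\<in>sets S. emeasure \<nu> B = \<infinity> \<or> emeasure \<nu> B \<in> \<nat>) \<and>
         (\<forall>a. emeasure \<nu> {s\<in>space S. \<forall>i<n. \<bar>pos s i\<bar> \<le> a} < \<infinity>)}"
proof -
  have "sets S \<noteq> {}" using sets.top by blast
  then show ?thesis unfolding counting_algebra_def space_Sup_eq_UN image_image space_vimage_algebra
    by (simp only: UN_constant if_False)
qed

lemma measurable_emeasure_counting_algebra:
  assumes "A \<in> sets S"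
  shows "(\<lambda>\<nu>. emeasure \<nu> A) \<in> borel_measurable (counting_algebra n S pos)"
  unfolding counting_algebra_def
  by (rule measurable_SUP1[OF assms]) (auto intro: measurable_vimage_algebra1)

lemma measurable_counting_algebraI:
  assumes "\<And>x. x \<in> space N \<Longrightarrow> u x \<in> space (counting_algebra n S pos)"
    and "\<And>A. A \<in> sets S \<Longrightarrow> (\<lambda>x. emeasure (u x) A) \<in> borel_measurable N"
  shows "u \<in> N \<rightarrow>\<^sub>M counting_algebra n S pos"
  unfolding counting_algebra_def
proof (rule measurable_SUP2)
  show "sets S \<noteq> {}" using sets.top by blast
  fix A assume A: "A \<in> sets S"
  show "u \<in> N \<rightarrow>\<^sub>M vimage_algebra
        {\<nu>. sets \<nu> = sets S \<and>
             (\<forall>B\<in>sets S. emeasure \<nu> B = \<infinity> \<or> emeasure \<nu> B \<in> \<nat>) \<and>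
             (\<forall>a. emeasure \<nu> {s\<in>space S. \<forall>i<n. \<bar>pos s i\<bar> \<le> a} < \<infinity>)}
        (\<lambda>\<nu>. emeasure \<nu> A) borel"
    by (rule measurable_vimage_algebra2)
      (use assms(1)[unfolded space_counting_algebra] assms(2)[OF A] in auto)
qed simp

lemma point_measure_eq_card:
  assumes X: "\<And>k. X k \<omega> \<in> space S" and A: "A \<in> sets S"
  shows "emeasure (point_measure S X \<omega>) A = emeasure (count_space UNIV) {k. X k \<omega> \<in> A}"
  unfolding point_measure_def using X A
  by (subst emeasure_distr) (auto simp: vimage_def intro!: arg_cong[where f = "emeasure _"])

lemma emeasure_point_measure:
  assumes "\<And>k. X k \<omega> \<in> space S" "A \<in> sets S"
  shows "emeasure (point_measure S X \<omega>) A = (\<Sum>k. indicator A (X k \<omega>))"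
proof -
  have "emeasure (count_space UNIV) {k. X k \<omega> \<in> A} = (\<integral>\<^sup>+k. indicator {k. X k \<omega> \<in> A} k \<partial>count_space UNIV)"
    by simp
  also have "\<dots> = (\<Sum>k. indicator A (X k \<omega>))"
    unfolding nn_integral_count_space_nat by (rule suminf_cong) (simp add: indicator_def)
  finally show ?thesis using point_measure_eq_card[where X = X, OF assms] by simp
qed

lemma point_measure_in_space:
  assumes X: "\<And>k. X k \<omega> \<in> space S" and fin: "\<And>a. finite {k. \<forall>i<n. \<bar>pos (X k \<omega>) i\<bar> \<le> a}"
  shows "point_measure S X \<omega> \<in> space (counting_algebra n S pos)"
  unfolding space_counting_algebra
proof (intro CollectI conjI ballI allI)
  show "sets (point_measure S X \<omega>) = sets S" by (simp add: point_measure_def)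
  show "emeasure (point_measure S X \<omega>) B = \<infinity> \<or> emeasure (point_measure S X \<omega>) B \<in> \<nat>"
    if B: "B \<in> sets S" for B
  proof -
    have "emeasure (point_measure S X \<omega>) B = emeasure (count_space UNIV) {k. X k \<omega> \<in> B}"
      by (rule point_measure_eq_card[where X = X, OF X B])
    then show ?thesis by (cases "finite {k. X k \<omega> \<in> B}") simp_all
  qed
  show "emeasure (point_measure S X \<omega>) {s \<in> space S. \<forall>i<n. \<bar>pos s i\<bar> \<le> a} < \<infinity>" for a
  proof (cases "{s \<in> space S. \<forall>i<n. \<bar>pos s i\<bar> \<le> a} \<in> sets S")
    case True
    have "emeasure (point_measure S X \<omega>) {s \<in> space S. \<forall>i<n. \<bar>pos s i\<bar> \<le> a}
        = emeasure (count_space UNIV) {k. X k \<omega> \<in> {s \<in> space S. \<forall>i<n. \<bar>pos s i\<bar> \<le> a}}"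
      by (rule point_measure_eq_card[where X = X, OF X True])
    also have "{k. X k \<omega> \<in> {s \<in> space S. \<forall>i<n. \<bar>pos s i\<bar> \<le> a}} = {k. \<forall>i<n. \<bar>pos (X k \<omega>) i\<bar> \<le> a}"
      by (simp add: X)
    finally show ?thesis using fin[of a] by (simp add: of_nat_less_top)
  next
    case False
    \<comment> \<open>\<open>pos\<close> is arbitrary here, so this set may fail to be measurable;
      its measure is then 0 by convention.\<close>
    then have "{s \<in> space S. \<forall>i<n. \<bar>pos s i\<bar> \<le> a} \<notin> sets (point_measure S X \<omega>)"
      unfolding point_measure_def sets_distr .
    from emeasure_notin_sets[OF this] show ?thesis by (simp only: infinity_ennreal_def ennreal_zero_less_top)
  qed
qed

lemma distr_point_measure:
  assumes "\<And>k. X k \<omega> \<in> space S" and "g \<in> S \<rightarrow>\<^sub>M S"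
  shows "distr (point_measure S X \<omega>) S g = point_measure S (\<lambda>k \<omega>. g (X k \<omega>)) \<omega>"
  unfolding point_measure_def using assms by (subst distr_distr) (auto simp: comp_def)

text \<open>A single labelled point has no invariant law, but the number of points in
  \<open>A\<close> is an evaluation of the counting measure, so its mean depends on the law of the
  configuration only. The hypothesis \<open>fin\<close> keeps the translated configuration inside
  the space of locally finite counting measures.\<close>

lemma stationary_pp_expected_count:
  assumes stat: "stationary_pp n M S pos sh X" and x: "x \<in> space (euclid n)"
    and sh: "sh x \<in> S \<rightarrow>\<^sub>M S" and A: "A \<in> sets S"
    and fin: "\<And>\<omega> a. \<omega> \<in> space M \<Longrightarrow> finite {k. \<forall>i<n. \<bar>pos (sh x (X k \<omega>)) i\<bar> \<le> a}"
  shows "(\<integral>\<^sup>+\<omega>. (\<Sum>k. indicator A (sh x (X k \<omega>))) \<partial>M) = (\<integral>\<^sup>+\<omega>. (\<Sum>k. indicator A (X k \<omega>)) \<partial>M)"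
proof -
  have pp: "point_process n M S pos X" using stat by (simp add: stationary_pp_def)
  have X [measurable]: "X k \<in> M \<rightarrow>\<^sub>M S" for k using pp by (simp add: point_process_def)
  let ?Y = "\<lambda>k \<omega>. sh x (X k \<omega>)"
  have Y [measurable]: "?Y k \<in> M \<rightarrow>\<^sub>M S" for k by (rule measurable_compose[OF X sh])
  have Xs: "X k \<omega> \<in> space S" "?Y k \<omega> \<in> space S" if "\<omega> \<in> space M" for k \<omega>
    using that measurable_space[OF X] measurable_space[OF Y] by auto
  have meas: "point_measure S Z \<in> M \<rightarrow>\<^sub>M counting_algebra n S pos"
    if Z [measurable]: "\<And>k. Z k \<in> M \<rightarrow>\<^sub>M S"
      and fin: "\<And>\<omega> a. \<omega> \<in> space M \<Longrightarrow> finite {k. \<forall>i<n. \<bar>pos (Z k \<omega>) i\<bar> \<le> a}" for Z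
  proof (rule measurable_counting_algebraI)
    show "point_measure S Z \<omega> \<in> space (counting_algebra n S pos)" if "\<omega> \<in> space M" for \<omega>
      using measurable_space[OF Z that] fin[OF that] by (rule point_measure_in_space)
    fix A assume [measurable]: "A \<in> sets S"
    have "(\<lambda>\<omega>. (\<Sum>k. indicator A (Z k \<omega>)) :: ennreal) \<in> borel_measurable M" by measurable
    then show "(\<lambda>\<omega>. emeasure (point_measure S Z \<omega>) A) \<in> borel_measurable M"
      by (rule measurable_cong[THEN iffD1, rotated])
        (use measurable_space[OF Z] in \<open>auto intro!: emeasure_point_measure[symmetric]\<close>)
  qed
  have mX: "point_measure S X \<in> M \<rightarrow>\<^sub>M counting_algebra n S pos"
    using pp by (intro meas X) (auto simp: point_process_def)
  have mY: "point_measure S ?Y \<in> M \<rightarrow>\<^sub>M counting_algebra n S pos"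
    by (intro meas Y fin)
  have "distr M (counting_algebra n S pos) (point_measure S ?Y)
      = distr M (counting_algebra n S pos) (\<lambda>\<omega>. distr (point_measure S X \<omega>) S (sh x))"
    using Xs sh by (intro distr_cong) (auto simp: distr_point_measure)
  also have "\<dots> = distr M (counting_algebra n S pos) (point_measure S X)"
    using stat x by (simp add: stationary_pp_def)
  finally have eq: "distr M (counting_algebra n S pos) (point_measure S ?Y)
    = distr M (counting_algebra n S pos) (point_measure S X)" .
  have int: "(\<integral>\<^sup>+\<nu>. emeasure \<nu> A \<partial>distr M (counting_algebra n S pos) (point_measure S Z))
      = (\<integral>\<^sup>+\<omega>. (\<Sum>k. indicator A (Z k \<omega>)) \<partial>M)"
    if Z: "\<And>k. Z k \<in> M \<rightarrow>\<^sub>M S" and m: "point_measure S Z \<in> M \<rightarrow>\<^sub>M counting_algebra n S pos" for Z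
    using measurable_space[OF Z] A
    by (subst nn_integral_distr[OF m])
      (auto intro!: nn_integral_cong emeasure_point_measure measurable_emeasure_counting_algebra)
  show ?thesis using int[OF X mX] int[OF Y mY] eq by simp
qed

section \<open>The probability of error\<close>

lemma vshift_commute: "x \<in> space (euclid n) \<Longrightarrow> y \<in> space (euclid n) \<Longrightarrow> vshift n x y = vshift n y x"
  by (auto simp: vshift_def add.commute)

lemma nn_integral_vshift:
  assumes "g \<in> borel_measurable (euclid n)"
  shows "(\<integral>\<^sup>+y. g (vshift n x y) \<partial>euclid n) = (\<integral>\<^sup>+y. g y \<partial>euclid n)"
  using nn_integral_distr[OF measurable_vshift, of g n x] assms by (simp add: distr_vshift)

lemma vshift_vneg_eq_origin:
  assumes "t \<in> space (euclid n)" "t' \<in> space (euclid n)"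
  shows "vshift n (vneg n t) t' = vorigin n \<longleftrightarrow> t' = t"
proof
  assume eq: "vshift n (vneg n t) t' = vorigin n"
  have "t' i = t i" for i
    using fun_cong[OF eq, of i] assms
    by (cases "i < n") (auto simp: vshift_def vneg_def vorigin_def space_euclid extensional_def)
  then show "t' = t" by auto
qed (auto simp: vshift_def vneg_def vorigin_def)

lemma vorigin_in_space [simp]: "vorigin n \<in> space (euclid n)"
  by (simp add: vorigin_def space_euclid)

lemma measurable_shift_pr: "shift_pr n x \<in> points_regions n \<rightarrow>\<^sub>M points_regions n"
  unfolding shift_pr_def by measurable

lemma measurable_shift_pdr: "shift_pdr n x \<in> points_disps_regions n \<rightarrow>\<^sub>M points_disps_regions n"
  unfolding shift_pdr_def by measurable

lemma finite_shifted_points: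
  fixes t :: "nat \<Rightarrow> vec"
  assumes "\<And>a. finite {k. \<forall>i<n. \<bar>t k i\<bar> \<le> a}"
  shows "finite {k. \<forall>i<n. \<bar>vshift n x (t k) i\<bar> \<le> a}"
proof (rule finite_subset[OF _ assms[of "a + (\<Sum>i<n. \<bar>x i\<bar>)"]], safe)
  fix k i assume *: "\<forall>i<n. \<bar>vshift n x (t k) i\<bar> \<le> a" and i: "i < n"
  have "\<bar>x i\<bar> \<le> (\<Sum>i<n. \<bar>x i\<bar>)" using i by (intro member_le_sum) auto
  moreover have "\<bar>t k i + x i\<bar> \<le> a" using *[rule_format, OF i] i by (simp add: vshift_def)
  ultimately show "\<bar>t k i\<bar> \<le> a + (\<Sum>i<n. \<bar>x i\<bar>)" by linarith
qed

text \<open>One fixed dimension, with displacement density \<open>f\<close> and intensity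
  \<open>lam\<close>; all estimates made here are non-asymptotic.\<close>

locale decoding = prob_space M for M :: "'w measure" +
  fixes n :: nat and T D :: "nat \<Rightarrow> 'w \<Rightarrow> vec" and C :: "nat \<Rightarrow> 'w \<Rightarrow> vec set"
    and f :: "vec \<Rightarrow> real" and lam :: real
  assumes regions: "jointly_stationary_regions n M T C"
    and inj_T: "AE \<omega> in M. inj (\<lambda>k. T k \<omega>)"
    and decomp: "AE \<omega> in M. decomposition n (\<lambda>k. C k \<omega>)"
    and measurable_f [measurable]: "f \<in> borel_measurable (euclid n)"
    and iid: "iid_displacements n M T C D (density (euclid n) f)"
    and lam_pos: "0 < lam"
    and intensity: "intensity n M id T = ennreal lam"
begin

lemma stationary: "stationary_pp n M (points_regions n) fst (shift_pr n) (\<lambda>k \<omega>. (T k \<omega>, C k \<omega>))"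
  using regions by (simp add: jointly_stationary_regions_def)

lemma measurable_TC [measurable]: "(\<lambda>\<omega>. (T k \<omega>, C k \<omega>)) \<in> M \<rightarrow>\<^sub>M points_regions n"
  using stationary by (simp add: stationary_pp_def point_process_def)

lemma measurable_T [measurable]: "T k \<in> M \<rightarrow>\<^sub>M euclid n"
  using measurable_compose[OF measurable_TC measurable_fst] by simp

lemma measurable_C [measurable]: "C k \<in> M \<rightarrow>\<^sub>M region_space n"
  using measurable_compose[OF measurable_TC measurable_snd] by simp

lemma measurable_D [measurable]: "D k \<in> M \<rightarrow>\<^sub>M euclid n"
  using iid by (simp add: iid_displacements_def indep_vars_def2)

lemma openin_C: "\<omega> \<in> space M \<Longrightarrow> openin (euclid_top n) (C k \<omega>)"
  using measurable_space[OF measurable_C] by (auto simp: space_region_space)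

lemma finite_points: "\<omega> \<in> space M \<Longrightarrow> finite {k. \<forall>i<n. \<bar>T k \<omega> i\<bar> \<le> a}"
  using stationary by (simp add: stationary_pp_def point_process_def)

lemma expected_count: "(\<integral>\<^sup>+\<omega>. (\<Sum>k. indicator (unit_cube n) (T k \<omega>)) \<partial>M) = ennreal lam"
  using intensity by (simp add: intensity_def)

lemma law_D: "distr M (euclid n) (D k) = density (euclid n) f"
  using iid by (simp add: iid_displacements_def)

text \<open>Independence is given between the whole family of displacements and the whole family of
  points and regions; an event about one label belongs to the \<sigma>-algebra generated by its
  family.\<close>

lemma joint_law:
  "distr M (euclid n \<Otimes>\<^sub>M points_regions n) (\<lambda>\<omega>. (D k \<omega>, (T k \<omega>, C k \<omega>)))
    = density (euclid n) f \<Otimes>\<^sub>M distr M (points_regions n) (\<lambda>\<omega>. (T k \<omega>, C k \<omega>))"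
proof -
  let ?PR = "points_regions n" and ?TC = "\<lambda>\<omega>. (T k \<omega>, C k \<omega>)"
  interpret L: prob_space "distr M (euclid n) (D k)" by (rule prob_space_distr) simp
  interpret R: prob_space "distr M ?PR ?TC" by (rule prob_space_distr) simp
  have sub: "Z k -` A \<inter> space M \<in> sets (vimage_algebra (space M) (\<lambda>\<omega> k. Z k \<omega>) (\<Pi>\<^sub>M k\<in>(UNIV :: nat set). K))"
    if Z: "\<And>k. Z k \<in> M \<rightarrow>\<^sub>M K" and A: "A \<in> sets K" for Z :: "nat \<Rightarrow> 'w \<Rightarrow> 'b" and K A
  proof -
    let ?V = "vimage_algebra (space M) (\<lambda>\<omega> k. Z k \<omega>) (\<Pi>\<^sub>M k\<in>(UNIV :: nat set). K)"
    have "(\<lambda>\<omega> k. Z k \<omega>) \<in> ?V \<rightarrow>\<^sub>M (\<Pi>\<^sub>M k\<in>UNIV. K)"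
      using measurable_space[OF Z] by (intro measurable_vimage_algebra1) (auto simp: space_PiM)
    from measurable_compose[OF this measurable_component_singleton[of k UNIV "\<lambda>_. K"]]
    have "Z k \<in> ?V \<rightarrow>\<^sub>M K" by simp
    from measurable_sets[OF this A] show ?thesis unfolding space_vimage_algebra .
  qed
  have ind: "indep_set (sets (vimage_algebra (space M) (\<lambda>\<omega> k. D k \<omega>) (\<Pi>\<^sub>M k\<in>UNIV. euclid n)))
      (sets (vimage_algebra (space M) (\<lambda>\<omega> k. (T k \<omega>, C k \<omega>)) (\<Pi>\<^sub>M k\<in>UNIV. ?PR)))"
    using iid unfolding iid_displacements_def by blast
  have "distr M (euclid n) (D k) \<Otimes>\<^sub>M distr M ?PR ?TC
      = distr M (euclid n \<Otimes>\<^sub>M ?PR) (\<lambda>\<omega>. (D k \<omega>, ?TC \<omega>))"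
  proof (rule pair_measure_eqI)
    show "sets (distr M (euclid n) (D k) \<Otimes>\<^sub>M distr M ?PR ?TC)
        = sets (distr M (euclid n \<Otimes>\<^sub>M ?PR) (\<lambda>\<omega>. (D k \<omega>, ?TC \<omega>)))"
      unfolding sets_distr by (intro sets_pair_measure_cong sets_distr)
  next
    fix A B assume "A \<in> sets (distr M (euclid n) (D k))" "B \<in> sets (distr M ?PR ?TC)"
    then have A: "A \<in> sets (euclid n)" and B: "B \<in> sets ?PR" unfolding sets_distr .
    have "prob ((D k -` A \<inter> space M) \<inter> (?TC -` B \<inter> space M)) = prob (D k -` A \<inter> space M) * prob (?TC -` B \<inter> space M)"
      by (rule indep_setD[OF ind sub[of D, OF measurable_D A] sub[of "\<lambda>k \<omega>. (T k \<omega>, C k \<omega>)", OF measurable_TC B]])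
    moreover have "(\<lambda>\<omega>. (D k \<omega>, ?TC \<omega>)) -` (A \<times> B) \<inter> space M = (D k -` A \<inter> space M) \<inter> (?TC -` B \<inter> space M)"
      by blast
    ultimately show "emeasure (distr M (euclid n) (D k)) A * emeasure (distr M ?PR ?TC) B
        = emeasure (distr M (euclid n \<Otimes>\<^sub>M ?PR) (\<lambda>\<omega>. (D k \<omega>, ?TC \<omega>))) (A \<times> B)"
      using emeasure_distr[OF measurable_D A, of k] emeasure_distr[OF measurable_TC B, of k]
        emeasure_distr[OF measurable_Pair[OF measurable_D measurable_TC] pair_measureI[OF A B], of k k]
      by (simp add: emeasure_eq_measure ennreal_mult)
  qed unfold_locales
  then show ?thesis unfolding law_D by (rule sym)
qed

text \<open>Mass transport. The volume of a region is an integral over y of the indicator that y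
  lies in it. For each y, translating the configuration by y replaces "T in the cube, y in C" by "T
  + y in the cube, 0 in C". Integration over y then gives the cube its volume 1 for each point, and
  there remains the expected number of regions containing the origin, at most 1 as they are
  disjoint.\<close>

lemma mean_volume_le_1:
  "(\<integral>\<^sup>+\<omega>. (\<Sum>k. indicator (unit_cube n) (T k \<omega>) * (\<integral>\<^sup>+y. indicator (C k \<omega>) y \<partial>euclid n)) \<partial>M) \<le> 1"
proof -
  interpret E: sigma_finite_measure "euclid n" by (rule sigma_finite_euclid)
  interpret ME: pair_sigma_finite M "euclid n" ..
  let ?Q = "unit_cube n"
  have [measurable]: "Measurable.pred (M \<Otimes>\<^sub>M euclid n) (\<lambda>x. snd x \<in> C k (fst x))" for k
    by measurable
  have [measurable]: "Measurable.pred M (\<lambda>\<omega>. vorigin n \<in> C k \<omega>)" for k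
    by (rule measurable_membership[of _ _ n]) simp_all
  have "(\<integral>\<^sup>+\<omega>. (\<Sum>k. indicator ?Q (T k \<omega>) * (\<integral>\<^sup>+y. indicator (C k \<omega>) y \<partial>euclid n)) \<partial>M)
      = (\<integral>\<^sup>+\<omega>. (\<integral>\<^sup>+y. (\<Sum>k. indicator ?Q (T k \<omega>) * indicator (C k \<omega>) y) \<partial>euclid n) \<partial>M)"
    using sets_region[OF openin_C]
    by (intro nn_integral_cong) (simp add: nn_integral_suminf nn_integral_cmult)
  also have "\<dots> = (\<integral>\<^sup>+y. (\<integral>\<^sup>+\<omega>. (\<Sum>k. indicator ?Q (T k \<omega>) * indicator (C k \<omega>) y) \<partial>M) \<partial>euclid n)"
    by (rule ME.Fubini'[symmetric]) (simp add: case_prod_beta)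
  also have "\<dots> = (\<integral>\<^sup>+y. (\<integral>\<^sup>+\<omega>. (\<Sum>k. indicator ?Q (vshift n y (T k \<omega>)) * indicator (C k \<omega>) (vorigin n)) \<partial>M) \<partial>euclid n)"
  proof (rule nn_integral_cong)
    fix y assume y: "y \<in> space (euclid n)"
    define A where "A = {p \<in> space (points_regions n). fst p \<in> ?Q \<and> y \<in> snd p}"
    have "Measurable.pred (points_regions n) (\<lambda>p. y \<in> snd p)"
      using y by (intro measurable_membership[of _ _ n]) simp_all
    then have A: "A \<in> sets (points_regions n)"
      unfolding A_def by measurable
    have TC: "(T k \<omega>, C k \<omega>) \<in> space (points_regions n)" if "\<omega> \<in> space M" for k \<omega>
      by (rule measurable_space[OF measurable_TC that])
    have shift_TC: "shift_pr n y (T k \<omega>, C k \<omega>) \<in> space (points_regions n)" if "\<omega> \<in> space M" for k \<omega>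
      by (rule measurable_space[OF measurable_shift_pr TC[OF that]])
    have "(\<integral>\<^sup>+\<omega>. (\<Sum>k. indicator ?Q (T k \<omega>) * indicator (C k \<omega>) y) \<partial>M)
        = (\<integral>\<^sup>+\<omega>. (\<Sum>k. indicator A (T k \<omega>, C k \<omega>)) \<partial>M)"
      using TC by (intro nn_integral_cong suminf_cong) (simp add: A_def indicator_def)
    also have "\<dots> = (\<integral>\<^sup>+\<omega>. (\<Sum>k. indicator A (shift_pr n y (T k \<omega>, C k \<omega>))) \<partial>M)"
      using finite_shifted_points[OF finite_points]
      by (intro stationary_pp_expected_count[OF stationary y measurable_shift_pr A, symmetric])
        (auto simp: shift_pr_def)
    also have "\<dots> = (\<integral>\<^sup>+\<omega>. (\<Sum>k. indicator ?Q (vshift n y (T k \<omega>)) * indicator (C k \<omega>) (vorigin n)) \<partial>M)"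
    proof (intro nn_integral_cong suminf_cong)
      fix \<omega> k assume \<omega>: "\<omega> \<in> space M"
      show "indicator A (shift_pr n y (T k \<omega>, C k \<omega>))
          = (indicator ?Q (vshift n y (T k \<omega>)) * indicator (C k \<omega>) (vorigin n) :: ennreal)"
        using shift_TC[OF \<omega>, of k] vshift_self_image_iff[OF openin_euclid_subset[OF openin_C[OF \<omega>]] y, of k]
        by (simp add: A_def indicator_def shift_pr_def)
    qed
    finally show "(\<integral>\<^sup>+\<omega>. (\<Sum>k. indicator ?Q (T k \<omega>) * indicator (C k \<omega>) y) \<partial>M)
      = (\<integral>\<^sup>+\<omega>. (\<Sum>k. indicator ?Q (vshift n y (T k \<omega>)) * indicator (C k \<omega>) (vorigin n)) \<partial>M)" .
  qed
  also have "\<dots> = (\<integral>\<^sup>+\<omega>. (\<integral>\<^sup>+y. (\<Sum>k. indicator ?Q (vshift n y (T k \<omega>)) * indicator (C k \<omega>) (vorigin n)) \<partial>euclid n) \<partial>M)"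
  proof (rule ME.Fubini')
    have [measurable]: "(\<lambda>p. vshift n (snd p) (T k (fst p))) \<in> M \<Otimes>\<^sub>M euclid n \<rightarrow>\<^sub>M euclid n" for k
      using measurable_compose[OF _ measurable_vshift2, of "\<lambda>p. (snd p, T k (fst p))" "M \<Otimes>\<^sub>M euclid n" n] by simp
    show "(\<lambda>(\<omega>, y). \<Sum>k. indicator ?Q (vshift n y (T k \<omega>)) * indicator (C k \<omega>) (vorigin n) :: ennreal)
        \<in> borel_measurable (M \<Otimes>\<^sub>M euclid n)"
      unfolding case_prod_beta by measurable
  qed
  also have "\<dots> = (\<integral>\<^sup>+\<omega>. (\<Sum>k. indicator (C k \<omega>) (vorigin n)) \<partial>M)"
  proof (rule nn_integral_cong)
    fix \<omega> assume \<omega>: "\<omega> \<in> space M"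
    have Ts: "T k \<omega> \<in> space (euclid n)" for k by (rule measurable_space[OF measurable_T \<omega>])
    have m: "(\<lambda>y. indicator ?Q (vshift n y (T k \<omega>)) :: ennreal) \<in> borel_measurable (euclid n)" for k
      by (rule measurable_cong[THEN iffD2, of _ _ "\<lambda>y. indicator ?Q (vshift n (T k \<omega>) y)"])
        (simp_all add: vshift_commute[OF Ts])
    have "(\<integral>\<^sup>+y. indicator ?Q (vshift n y (T k \<omega>)) \<partial>euclid n) = (\<integral>\<^sup>+y. indicator ?Q (vshift n (T k \<omega>) y) \<partial>euclid n)" for k
      by (intro nn_integral_cong) (simp add: vshift_commute[OF Ts])
    also have "\<dots> k = 1" for k
      by (subst nn_integral_vshift) (simp_all add: emeasure_unit_cube)
    finally have one: "(\<integral>\<^sup>+y. indicator ?Q (vshift n y (T k \<omega>)) \<partial>euclid n) = 1" for k .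
    show "(\<integral>\<^sup>+y. (\<Sum>k. indicator ?Q (vshift n y (T k \<omega>)) * indicator (C k \<omega>) (vorigin n)) \<partial>euclid n)
        = (\<Sum>k. indicator (C k \<omega>) (vorigin n))"
      using m by (simp add: nn_integral_suminf nn_integral_multc one)
  qed
  also have "\<dots> \<le> (\<integral>\<^sup>+\<omega>. 1 \<partial>M)"
  proof (rule nn_integral_mono_AE)
    show "AE \<omega> in M. (\<Sum>k. indicator (C k \<omega>) (vorigin n) :: ennreal) \<le> 1"
      using decomp
    proof eventually_elim
      case (elim \<omega>)
      then have "disjoint_family (\<lambda>k. C k \<omega>)" by (simp add: decomposition_def)
      then show ?case by (subst suminf_indicator) (auto simp: indicator_def)
    qed
  qed
  finally show ?thesis by (simp add: emeasure_space_1)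
qed

text \<open>Given the point t and its region U, the displacement still has density \<open>f\<close>.
  Its mass on U - t is split: where \<open>f\<close> exceeds \<open>\<tau>\<close> all the mass is
  conceded, elsewhere \<open>f\<close> is at most \<open>\<tau>\<close> and the volume of U - t is
  that of U.\<close>

lemma hit_bound:
  assumes \<tau>: "0 \<le> \<tau>"
  shows "(\<integral>\<^sup>+\<omega>. indicator (unit_cube n) (T k \<omega>) * indicator (C k \<omega>) (vshift n (T k \<omega>) (D k \<omega>)) \<partial>M)
    \<le> (\<integral>\<^sup>+\<omega>. indicator (unit_cube n) (T k \<omega>) *
          (emeasure (density (euclid n) f) {w \<in> space (euclid n). \<tau> < f w}
            + ennreal \<tau> * (\<integral>\<^sup>+y. indicator (C k \<omega>) y \<partial>euclid n)) \<partial>M)"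
proof -
  let ?Q = "unit_cube n" and ?L = "density (euclid n) f" and ?B = "{w \<in> space (euclid n). \<tau> < f w}"
  let ?PR = "points_regions n"
  let ?R = "distr M ?PR (\<lambda>\<omega>. (T k \<omega>, C k \<omega>))"
  interpret L: prob_space ?L unfolding law_D[of k, symmetric] by (rule prob_space_distr) simp
  interpret R: prob_space ?R by (rule prob_space_distr) simp
  interpret E: sigma_finite_measure "euclid n" by (rule sigma_finite_euclid)
  interpret LR: pair_sigma_finite ?L ?R ..
  define g where "g = (\<lambda>(d, t, U). indicator ?Q t * indicator U (vshift n t d) :: ennreal)"
  have [measurable]: "(\<lambda>p. vshift n (fst (snd p)) (fst p)) \<in> euclid n \<Otimes>\<^sub>M ?PR \<rightarrow>\<^sub>M euclid n"
    using measurable_compose[OF _ measurable_vshift2, of "\<lambda>p. (fst (snd p), fst p)" "euclid n \<Otimes>\<^sub>M ?PR" n] by simp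
  have g [measurable]: "g \<in> borel_measurable (euclid n \<Otimes>\<^sub>M ?PR)"
    unfolding g_def case_prod_beta by measurable
  have g': "g \<in> borel_measurable (?L \<Otimes>\<^sub>M ?R)"
    using g by (simp cong: measurable_cong_sets)
  have vol [measurable]: "(\<lambda>p. \<integral>\<^sup>+y. indicator (snd p) y \<partial>euclid n) \<in> borel_measurable ?PR"
    by (rule E.borel_measurable_nn_integral) (simp add: case_prod_beta)
  have "(\<integral>\<^sup>+\<omega>. indicator ?Q (T k \<omega>) * indicator (C k \<omega>) (vshift n (T k \<omega>) (D k \<omega>)) \<partial>M)
      = (\<integral>\<^sup>+\<omega>. g (D k \<omega>, (T k \<omega>, C k \<omega>)) \<partial>M)"
    by (simp add: g_def)
  also have "\<dots> = (\<integral>\<^sup>+p. g p \<partial>distr M (euclid n \<Otimes>\<^sub>M ?PR) (\<lambda>\<omega>. (D k \<omega>, (T k \<omega>, C k \<omega>))))"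
    by (rule nn_integral_distr[symmetric]) simp_all
  also have "\<dots> = (\<integral>\<^sup>+q. (\<integral>\<^sup>+d. g (d, q) \<partial>?L) \<partial>?R)"
    unfolding joint_law by (rule LR.nn_integral_snd[OF g', symmetric])
  also have "\<dots> \<le> (\<integral>\<^sup>+q. indicator ?Q (fst q) * (emeasure ?L ?B + ennreal \<tau> * (\<integral>\<^sup>+y. indicator (snd q) y \<partial>euclid n)) \<partial>?R)"
  proof (rule nn_integral_mono)
    fix q assume "q \<in> space ?R"
    then obtain t U where q: "q = (t, U)" and t: "t \<in> space (euclid n)" and U: "openin (euclid_top n) U"
      by (auto simp: space_pair_measure space_region_space)
    have [measurable]: "U \<in> sets (euclid n)" by (rule sets_region[OF U])
    have "(\<integral>\<^sup>+d. indicator U (vshift n t d) \<partial>?L) = (\<integral>\<^sup>+d. ennreal (f d) * indicator U (vshift n t d) \<partial>euclid n)"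
      by (rule nn_integral_density) simp_all
    also have "\<dots> \<le> (\<integral>\<^sup>+d. ennreal (f d) * indicator ?B d + ennreal \<tau> * indicator U (vshift n t d) \<partial>euclid n)"
      by (intro nn_integral_mono) (auto simp: indicator_def ennreal_leI not_less)
    also have "\<dots> = emeasure ?L ?B + ennreal \<tau> * (\<integral>\<^sup>+d. indicator U (vshift n t d) \<partial>euclid n)"
      by (simp add: nn_integral_add nn_integral_cmult emeasure_density)
    also have "(\<integral>\<^sup>+d. indicator U (vshift n t d) \<partial>euclid n) = (\<integral>\<^sup>+y. indicator U y \<partial>euclid n)"
      by (rule nn_integral_vshift) simp
    finally have "(\<integral>\<^sup>+d. indicator U (vshift n t d) \<partial>?L) \<le> emeasure ?L ?B + ennreal \<tau> * (\<integral>\<^sup>+y. indicator U y \<partial>euclid n)" .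
    then show "(\<integral>\<^sup>+d. g (d, q) \<partial>?L) \<le> indicator ?Q (fst q) * (emeasure ?L ?B + ennreal \<tau> * (\<integral>\<^sup>+y. indicator (snd q) y \<partial>euclid n))"
      by (simp add: g_def q indicator_def)
  qed
  also have "\<dots> = (\<integral>\<^sup>+\<omega>. indicator ?Q (T k \<omega>) * (emeasure ?L ?B + ennreal \<tau> * (\<integral>\<^sup>+y. indicator (C k \<omega>) y \<partial>euclid n)) \<partial>M)"
    by (subst nn_integral_distr) simp_all
  finally show ?thesis .
qed

lemma measurable_hit [measurable]: "Measurable.pred M (\<lambda>\<omega>. vshift n (T k \<omega>) (D k \<omega>) \<in> C k \<omega>)"
  using measurable_compose[OF _ measurable_vshift2, of "\<lambda>\<omega>. (T k \<omega>, D k \<omega>)" M n]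
  by (intro measurable_membership[of _ _ n]) simp_all

text \<open>Summed over the labels, the first term of \<open>hit_bound\<close> is multiplied by the
  mean number of points in the cube, and the volumes in the second are controlled by
  \<open>mean_volume_le_1\<close>.\<close>

lemma expected_hits_le:
  assumes \<tau>: "0 \<le> \<tau>"
  shows "(\<integral>\<^sup>+\<omega>. (\<Sum>k. indicator (unit_cube n) (T k \<omega>) * indicator (C k \<omega>) (vshift n (T k \<omega>) (D k \<omega>))) \<partial>M)
    \<le> emeasure (density (euclid n) f) {w \<in> space (euclid n). \<tau> < f w} * ennreal lam + ennreal \<tau>"
proof -
  let ?Q = "unit_cube n"
  let ?a = "emeasure (density (euclid n) f) {w \<in> space (euclid n). \<tau> < f w}"
  let ?v = "\<lambda>k \<omega>. \<integral>\<^sup>+y. indicator (C k \<omega>) y \<partial>euclid n"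
  interpret E: sigma_finite_measure "euclid n" by (rule sigma_finite_euclid)
  have [measurable]: "Measurable.pred (M \<Otimes>\<^sub>M euclid n) (\<lambda>x. snd x \<in> C k (fst x))" for k
    by measurable
  have [measurable]: "?v k \<in> borel_measurable M" for k
    by (rule E.borel_measurable_nn_integral) (simp add: case_prod_beta)
  have "(\<integral>\<^sup>+\<omega>. (\<Sum>k. indicator ?Q (T k \<omega>) * indicator (C k \<omega>) (vshift n (T k \<omega>) (D k \<omega>))) \<partial>M)
      = (\<Sum>k. \<integral>\<^sup>+\<omega>. indicator ?Q (T k \<omega>) * indicator (C k \<omega>) (vshift n (T k \<omega>) (D k \<omega>)) \<partial>M)"
    by (rule nn_integral_suminf) simp
  also have "\<dots> \<le> (\<Sum>k. \<integral>\<^sup>+\<omega>. indicator ?Q (T k \<omega>) * (?a + ennreal \<tau> * ?v k \<omega>) \<partial>M)"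
    by (intro suminf_le hit_bound \<tau>) auto
  also have "\<dots> = (\<integral>\<^sup>+\<omega>. (\<Sum>k. indicator ?Q (T k \<omega>) * (?a + ennreal \<tau> * ?v k \<omega>)) \<partial>M)"
    by (rule nn_integral_suminf[symmetric]) simp
  also have "\<dots> = (\<integral>\<^sup>+\<omega>. ?a * (\<Sum>k. indicator ?Q (T k \<omega>)) + ennreal \<tau> * (\<Sum>k. indicator ?Q (T k \<omega>) * ?v k \<omega>) \<partial>M)"
  proof (rule nn_integral_cong)
    fix \<omega>
    let ?u = "\<lambda>k. indicator ?Q (T k \<omega>) :: ennreal"
    have "(\<Sum>k. ?u k * (?a + ennreal \<tau> * ?v k \<omega>)) = (\<Sum>k. ?a * ?u k + ennreal \<tau> * (?u k * ?v k \<omega>))"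
      by (rule suminf_cong) (simp add: distrib_left mult_ac)
    also have "\<dots> = (\<Sum>k. ?a * ?u k) + (\<Sum>k. ennreal \<tau> * (?u k * ?v k \<omega>))"
      by (rule suminf_add[symmetric]) auto
    finally show "(\<Sum>k. ?u k * (?a + ennreal \<tau> * ?v k \<omega>))
        = ?a * (\<Sum>k. ?u k) + ennreal \<tau> * (\<Sum>k. ?u k * ?v k \<omega>)"
      unfolding ennreal_suminf_cmult .
  qed
  also have "\<dots> = ?a * (\<integral>\<^sup>+\<omega>. (\<Sum>k. indicator ?Q (T k \<omega>)) \<partial>M)
      + ennreal \<tau> * (\<integral>\<^sup>+\<omega>. (\<Sum>k. indicator ?Q (T k \<omega>) * ?v k \<omega>) \<partial>M)"
    by (simp add: nn_integral_add nn_integral_cmult)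
  also have "\<dots> \<le> ?a * ennreal lam + ennreal \<tau> * 1"
    unfolding expected_count by (intro add_left_mono mult_left_mono mean_volume_le_1) simp
  finally show ?thesis by simp
qed

text \<open>After translation by minus the point \<open>k\<close>, the atoms at the origin are the
  labels with the same location, and injectivity leaves \<open>k\<close> alone. The region has moved
  and the displacement has not, so that d lying outside U - t becomes t + d lying outside U.\<close>

lemma error_event_iff:
  assumes \<omega>: "\<omega> \<in> space M" and inj: "inj (\<lambda>k. T k \<omega>)"
  shows "distr (point_measure (points_disps_regions n) (\<lambda>k \<omega>. (T k \<omega>, D k \<omega>, C k \<omega>)) \<omega>) (points_disps_regions n)
      (shift_pdr n (vneg n (T k \<omega>))) \<in> error_event n \<longleftrightarrow> vshift n (T k \<omega>) (D k \<omega>) \<notin> C k \<omega>"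
proof -
  let ?S = "points_disps_regions n" and ?x = "vneg n (T k \<omega>)"
  let ?Y = "\<lambda>j \<omega>. (T j \<omega>, D j \<omega>, C j \<omega>)"
  let ?Z = "\<lambda>j \<omega>'. shift_pdr n ?x (?Y j \<omega>')"
  let ?W = "{(t, d, U) \<in> space ?S. t = vorigin n \<and> d \<notin> U}"
  have Ts: "T j \<omega> \<in> space (euclid n)" and Ds: "D j \<omega> \<in> space (euclid n)" for j
    using measurable_space[OF measurable_T \<omega>] measurable_space[OF measurable_D \<omega>] by auto
  have "?Y j \<in> M \<rightarrow>\<^sub>M ?S" for j by measurable
  then have Ys: "?Y j \<omega> \<in> space ?S" for j using measurable_space[OF _ \<omega>] by blast
  have Zs: "?Z j \<omega> \<in> space ?S" for j by (rule measurable_space[OF measurable_shift_pdr Ys])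
  have eq: "distr (point_measure ?S ?Y \<omega>) ?S (shift_pdr n ?x) = point_measure ?S ?Z \<omega>"
    by (rule distr_point_measure[where X = ?Y, OF Ys measurable_shift_pdr])
  have origin: "{vorigin n} = (\<Pi>\<^sub>E i\<in>{..<n}. {0})"
    by (auto simp: vorigin_def PiE_def extensional_def fun_eq_iff)
  have [measurable]: "{vorigin n} \<in> sets (euclid n)"
    unfolding origin euclid_def by (rule sets_PiM_I_finite) auto
  have "?W = {p \<in> space ?S. fst p \<in> {vorigin n} \<and> \<not> fst (snd p) \<in> snd (snd p)}" by auto
  also have "\<dots> \<in> sets ?S" by measurable
  finally have W: "?W \<in> sets ?S" .
  have fin: "finite {j. \<forall>i<n. \<bar>fst (?Z j \<omega>) i\<bar> \<le> a}" for a
    using finite_shifted_points[OF finite_points[OF \<omega>]] by (simp add: shift_pdr_def)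
  have "point_measure ?S ?Z \<omega> \<in> error_event n \<longleftrightarrow> emeasure (point_measure ?S ?Z \<omega>) ?W \<noteq> 0"
    using point_measure_in_space[where X = ?Z, OF Zs fin] by (simp add: error_event_def)
  also have "\<dots> \<longleftrightarrow> (\<exists>j. ?Z j \<omega> \<in> ?W)"
    by (subst point_measure_eq_card[where X = ?Z, OF Zs W]) (auto simp: emeasure_count_space_eq_0)
  also have "\<dots> \<longleftrightarrow> (\<exists>j. T j \<omega> = T k \<omega> \<and> vshift n (T k \<omega>) (D j \<omega>) \<notin> C j \<omega>)"
    using Zs Ds vshift_vneg_eq_origin[OF Ts Ts] vshift_vneg_image_iff[OF openin_euclid_subset[OF openin_C[OF \<omega>]] Ds]
    by (simp add: shift_pdr_def)
  also have "\<dots> \<longleftrightarrow> vshift n (T k \<omega>) (D k \<omega>) \<notin> C k \<omega>"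
    using injD[OF inj] by auto
  finally show ?thesis unfolding eq .
qed

text \<open>Each point of the unit cube is a hit or a miss, so the two expected numbers add up to
  \<open>lam\<close>; an upper bound on the hits is thus a lower bound on the error.\<close>

lemma error_prob_bounds:
  assumes \<tau>: "0 \<le> \<tau>"
  shows "1 - (measure (density (euclid n) f) {w \<in> space (euclid n). \<tau> < f w} + \<tau> / lam) \<le> error_prob n M T D C"
    and "error_prob n M T D C \<le> 1"
proof -
  let ?Q = "unit_cube n"
  let ?L = "density (euclid n) f"
  define a where "a = measure ?L {w \<in> space (euclid n). \<tau> < f w}"
  interpret L: prob_space ?L unfolding law_D[of 0, symmetric] by (rule prob_space_distr) simp
  let ?hit = "\<lambda>k \<omega>. indicator (C k \<omega>) (vshift n (T k \<omega>) (D k \<omega>)) :: ennreal"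
  let ?miss = "\<lambda>k \<omega>. indicator (- C k \<omega>) (vshift n (T k \<omega>) (D k \<omega>)) :: ennreal"
  define p where "p = (\<integral>\<^sup>+\<omega>. (\<Sum>k. indicator ?Q (T k \<omega>) * ?hit k \<omega>) \<partial>M)"
  define e where "e = (\<integral>\<^sup>+\<omega>. (\<Sum>k. indicator ?Q (T k \<omega>) * ?miss k \<omega>) \<partial>M)"
  have "(\<integral>\<^sup>+\<omega>. (\<Sum>k. indicator ?Q (T k \<omega>) *
        indicator (error_event n) (distr (point_measure (points_disps_regions n) (\<lambda>k \<omega>. (T k \<omega>, D k \<omega>, C k \<omega>)) \<omega>)
          (points_disps_regions n) (shift_pdr n (vneg n (T k \<omega>))))) \<partial>M) = e"
    unfolding e_def
  proof (rule nn_integral_cong_AE)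
    show "AE \<omega> in M. (\<Sum>k. indicator ?Q (T k \<omega>) *
        indicator (error_event n) (distr (point_measure (points_disps_regions n) (\<lambda>k \<omega>. (T k \<omega>, D k \<omega>, C k \<omega>)) \<omega>)
          (points_disps_regions n) (shift_pdr n (vneg n (T k \<omega>))))) = (\<Sum>k. indicator ?Q (T k \<omega>) * ?miss k \<omega>)"
      using inj_T AE_space
    proof eventually_elim
      case (elim \<omega>)
      show ?case by (intro suminf_cong) (simp add: indicator_def error_event_iff[OF elim(2,1)])
    qed
  qed
  then have err: "error_prob n M T D C = enn2real (e / ennreal lam)"
    using intensity by (simp add: error_prob_def palm_prob_def intensity_def)
  have "e + p = (\<integral>\<^sup>+\<omega>. (\<Sum>k. indicator ?Q (T k \<omega>) * ?miss k \<omega>) + (\<Sum>k. indicator ?Q (T k \<omega>) * ?hit k \<omega>) \<partial>M)"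
    unfolding e_def p_def by (rule nn_integral_add[symmetric]) measurable
  also have "\<dots> = (\<integral>\<^sup>+\<omega>. (\<Sum>k. indicator ?Q (T k \<omega>)) \<partial>M)"
  proof (rule nn_integral_cong)
    fix \<omega>
    have "(\<Sum>k. indicator ?Q (T k \<omega>) * ?miss k \<omega>) + (\<Sum>k. indicator ?Q (T k \<omega>) * ?hit k \<omega>)
        = (\<Sum>k. indicator ?Q (T k \<omega>) * ?miss k \<omega> + indicator ?Q (T k \<omega>) * ?hit k \<omega>)"
      by (rule suminf_add) auto
    also have "\<dots> = (\<Sum>k. indicator ?Q (T k \<omega>))"
      by (intro suminf_cong) (auto simp: indicator_def)
    finally show "(\<Sum>k. indicator ?Q (T k \<omega>) * ?miss k \<omega>) + (\<Sum>k. indicator ?Q (T k \<omega>) * ?hit k \<omega>) = (\<Sum>k. indicator ?Q (T k \<omega>))" .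
  qed
  finally have sum: "e + p = ennreal lam" by (simp add: expected_count)
  have "p \<le> ennreal a * ennreal lam + ennreal \<tau>"
    using expected_hits_le[OF \<tau>] unfolding p_def a_def L.emeasure_eq_measure .
  then have p_le: "p \<le> ennreal (a * lam + \<tau>)"
    using lam_pos \<tau> by (simp add: a_def ennreal_mult ennreal_plus)
  have fin: "e < \<top>" "p < \<top>"
    using sum by (metis ennreal_add_less_top ennreal_less_top)+
  obtain e' p' where ep: "0 \<le> e'" "e = ennreal e'" "0 \<le> p'" "p = ennreal p'"
    using fin by (metis enn2real_nonneg ennreal_enn2real)
  have s: "e' + p' = lam"
    using sum ep lam_pos by (simp flip: ennreal_plus)
  have "0 \<le> a * lam + \<tau>" using lam_pos \<tau> by (simp add: a_def)
  then have "p' \<le> a * lam + \<tau>"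
    using p_le unfolding ep(4) by (subst (asm) ennreal_le_iff)
  then have "p' / lam \<le> a + \<tau> / lam" using lam_pos by (simp add: field_simps)
  moreover have "error_prob n M T D C = e' / lam"
    using err ep lam_pos by (simp add: divide_ennreal)
  moreover have "e' / lam = 1 - p' / lam" using s lam_pos by (simp add: field_simps)
  moreover have "0 \<le> p' / lam" using ep lam_pos by simp
  ultimately show "1 - (measure ?L {w \<in> space (euclid n). \<tau> < f w} + \<tau> / lam) \<le> error_prob n M T D C"
    and "error_prob n M T D C \<le> 1"
    unfolding a_def by linarith+
qed

end

section \<open>The converse theorem\<close>

lemma ergodic_densities_path_law:
  assumes N: "prob_space N" and stat: "stationary_sequence N X" and erg: "ergodic_sequence N X"
    and fe: "\<And>n. n \<ge> 1 \<Longrightarrow> information_space.finite_entropy N (exp 1) (euclid n) (init_vec X n) (f n)"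
    and rate: "(\<lambda>n. diff_entropy N X n / real n) \<longlonglongrightarrow> h"
  shows "ergodic_densities (path_law N X) f h"
proof -
  interpret N: information_space N "exp 1"
    by (intro information_space.intro N information_space_axioms.intro) simp
  have X: "X l \<in> borel_measurable N" for l using stat by (simp add: stationary_sequence_def)
  let ?B = "\<Pi>\<^sub>M l\<in>(UNIV :: nat set). (borel :: real measure)"
  let ?P = "path_law N X" and ?s = "\<lambda>x l. (x :: nat \<Rightarrow> real) (Suc l)"
  have path: "(\<lambda>\<omega> l. X l \<omega>) \<in> N \<rightarrow>\<^sub>M ?B"
    by (rule measurable_PiM_single') (use X in auto)
  have sets_P: "sets ?P = sets ?B" unfolding path_law_def by (rule sets_distr)
  have shift: "?s \<in> ?B \<rightarrow>\<^sub>M ?B"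
    by (rule measurable_PiM_single') (auto intro: measurable_component_singleton)
  have space_P: "space ?P = UNIV" unfolding path_law_def by (simp add: space_PiM)
  have dist: "distributed N (euclid n) (init_vec X n) (f n)" and nn: "\<And>w. w \<in> space (euclid n) \<Longrightarrow> 0 \<le> f n w"
    if "n \<ge> 1" for n
    using fe[OF that] by (auto simp: N.finite_entropy_def)
  have ln: "log (exp 1) x = ln x" for x :: real by (simp add: log_def)
  have init: "window 0 n \<circ> (\<lambda>\<omega> l. X l \<omega>) = init_vec X n" for n
    by (auto simp: window_def init_vec_def fun_eq_iff)
  show ?thesis
  proof (intro ergodic_densities.intro ergodic_map.intro ergodic_map_axioms.intro ergodic_densities_axioms.intro)
    show "prob_space ?P" unfolding path_law_def by (rule N.prob_space_distr[OF path])
    show "?s \<in> ?P \<rightarrow>\<^sub>M ?P" using shift measurable_cong_sets[OF sets_P sets_P] by blast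
    have "distr ?P ?P ?s = distr ?P ?B ?s" by (rule distr_cong) (simp_all add: sets_P)
    also have "\<dots> = path_law N (\<lambda>l. X (Suc l))"
      unfolding path_law_def by (subst distr_distr[OF shift path]) (simp add: comp_def)
    also have "\<dots> = ?P" using stat by (simp add: stationary_sequence_def)
    finally show "distr ?P ?P ?s = ?P" .
    show "measure ?P A \<in> {0, 1}" if "A \<in> sets ?P" "?s -` A \<inter> space ?P = A" for A
      using erg that unfolding ergodic_sequence_def sets_P space_P Int_UNIV_right by blast
    show "sets ?P = sets ?B" by (rule sets_P)
    show "distr ?P (euclid n) (window 0 n) = density (euclid n) (\<lambda>x. ennreal (f n x))" if "n \<ge> 1" for n
      unfolding path_law_def distr_distr[OF measurable_window path] init
      using dist[OF that] by (simp add: distributed_def)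
    show "f n \<in> borel_measurable (euclid n)" if "n \<ge> 1" for n
      by (rule N.finite_entropy_measurable[OF fe[OF that]])
    show "0 \<le> f n w" if "n \<ge> 1" "w \<in> space (euclid n)" for n w
      by (rule nn[OF that])
    show "integrable (euclid n) (\<lambda>w. f n w * ln (f n w))" if "n \<ge> 1" for n
      using N.finite_entropy_integrable[OF fe[OF that]] unfolding ln .
    have "diff_entropy N X n = - (\<integral>w. f n w * ln (f n w) \<partial>euclid n)" if n: "n \<ge> 1" for n
      unfolding diff_entropy_def by (subst N.entropy_distr[OF dist[OF n] nn[OF n]]) (simp_all add: ln)
    \<comment> \<open>The identity is available for \<open>n \<ge> 1\<close> only, which suffices
      for the limit.\<close>
    then have "\<forall>\<^sub>F n in sequentially. diff_entropy N X n / real n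
        = - (\<integral>w. f n w * ln (f n w) \<partial>euclid n) / real n"
      by (intro eventually_sequentiallyI[of 1]) simp
    with rate show "(\<lambda>n. - (\<integral>w. f n w * ln (f n w) \<partial>euclid n) / real n) \<longlonglongrightarrow> h"
      by (rule Lim_transform_eventually)
  qed
qed

theorem mainTheorem1:
  fixes N :: "'v measure" and X :: "nat \<Rightarrow> 'v \<Rightarrow> real" and f :: "nat \<Rightarrow> vec \<Rightarrow> real"
    and h c :: real
    and M :: "nat \<Rightarrow> 'w measure"
    and T D :: "nat \<Rightarrow> nat \<Rightarrow> 'w \<Rightarrow> vec" and C :: "nat \<Rightarrow> nat \<Rightarrow> 'w \<Rightarrow> vec set"
    and R :: "nat \<Rightarrow> real" and r :: "nat \<Rightarrow> nat"
  assumes "prob_space N"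
    and "stationary_sequence N X" and "ergodic_sequence N X"
    and "\<And>l. integrable N (X l)" and "\<And>l. (\<integral>\<omega>. X l \<omega> \<partial>N) = 0"
    and "\<And>n. n \<ge> 1 \<Longrightarrow>
      information_space.finite_entropy N (exp 1) (euclid n) (init_vec X n) (f n)"
    and "(\<lambda>n. diff_entropy N X n / real n) \<longlonglongrightarrow> h"
    and "c = - h"
    and "\<And>n. n \<ge> 1 \<Longrightarrow> simple_stationary_ergodic n (M n) (T n)"
    and "\<And>n. n \<ge> 1 \<Longrightarrow> intensity n (M n) id (T n) = ennreal (exp (real n * R n))"
    and "strict_mono r" and "\<And>k. r k \<ge> 1"
    and "liminf (\<lambda>k. ereal (R (r k))) > ereal c"
    and "\<And>n. n \<ge> 1 \<Longrightarrow> jointly_stationary_regions n (M n) (T n) (C n)"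
    and "\<And>n. n \<ge> 1 \<Longrightarrow> AE \<omega> in M n. decomposition n (\<lambda>k. C n k \<omega>)"
    and "\<And>n. n \<ge> 1 \<Longrightarrow>
      iid_displacements n (M n) (T n) (C n) (D n) (distr N (euclid n) (init_vec X n))"
  shows "(\<lambda>k. error_prob (r k) (M (r k)) (T (r k)) (D (r k)) (C (r k))) \<longlonglongrightarrow> 1"
proof -
  interpret P: ergodic_densities "path_law N X" f h
    by (rule ergodic_densities_path_law) (use assms in auto)
  let ?L = "\<lambda>n. density (euclid n) (f n)"
  let ?e = "\<lambda>k. error_prob (r k) (M (r k)) (T (r k)) (D (r k)) (C (r k))"
  obtain y where y: "ereal c < ereal y" "ereal y < liminf (\<lambda>k. ereal (R (r k)))"
    using ereal_dense2[OF assms(13)] by blast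
  \<comment> \<open>Half of the gap between \<open>y\<close> and \<open>- h\<close>. With
    \<open>y = 2 * d - h\<close>, the quotient of threshold and intensity has exponent at most - n
    (h - d) - n y = - n d.\<close>
  define d where "d = (y + h) / 2"
  have d: "0 < d" using y(1) assms(8) by (simp add: d_def)
  have yd: "y = 2 * d - h" by (simp add: d_def field_simps)
  have R: "\<forall>\<^sub>F k in sequentially. y < R (r k)"
    using less_LiminfD[OF y(2)] by simp
  let ?b = "\<lambda>k. measure (?L (r k)) {w \<in> space (euclid (r k)). exp (- (real (r k) * (h - d))) < f (r k) w}"
  have bounds: "1 - (?b k + exp (- (real (r k) * (h - d))) / exp (real (r k) * R (r k))) \<le> ?e k" "?e k \<le> 1" for k
  proof -
    have n: "r k \<ge> 1" by (rule assms(12))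
    have "distr N (euclid (r k)) (init_vec X (r k)) = ?L (r k)"
    proof -
      interpret N: information_space N "exp 1"
        by (intro information_space.intro assms(1) information_space_axioms.intro) simp
      show ?thesis using N.finite_entropy_distributed[OF assms(6)[OF n]] by (simp add: distributed_def)
    qed
    then have "decoding (M (r k)) (r k) (T (r k)) (D (r k)) (C (r k)) (f (r k)) (exp (real (r k) * R (r k)))"
      using assms(9,10,14,15,16)[OF n] P.measurable_f[OF n]
      by (intro decoding.intro decoding_axioms.intro)
        (simp_all add: simple_stationary_ergodic_def stationary_pp_def point_process_def)
    then interpret decoding "M (r k)" "r k" "T (r k)" "D (r k)" "C (r k)" "f (r k)" "exp (real (r k) * R (r k))" .
    show "1 - (?b k + exp (- (real (r k) * (h - d))) / exp (real (r k) * R (r k))) \<le> ?e k"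
      by (rule error_prob_bounds(1)) simp
    \<comment> \<open>The threshold does not occur in this bound, so 0 is chosen.\<close>
    show "?e k \<le> 1" by (rule error_prob_bounds(2)[OF order_refl])
  qed
  have b: "?b \<longlonglongrightarrow> 0"
    using LIMSEQ_subseq_LIMSEQ[OF P.density_concentration[OF d] assms(11)] by (simp add: comp_def)
  have "(\<lambda>k. exp (- (real (r k) * (h - d))) / exp (real (r k) * R (r k))) \<longlonglongrightarrow> 0"
  proof (rule tendsto_sandwich[of "\<lambda>_. 0"])
    show "\<forall>\<^sub>F k in sequentially. exp (- (real (r k) * (h - d))) / exp (real (r k) * R (r k)) \<le> exp (- d) ^ r k"
      using R
    proof eventually_elim
      case (elim k)
      have "real (r k) * y \<le> real (r k) * R (r k)" using elim by (intro mult_left_mono) auto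
      then have "- (real (r k) * (h - d)) - real (r k) * R (r k) \<le> real (r k) * (- d)"
        by (simp add: yd algebra_simps)
      then show ?case by (simp flip: exp_diff exp_of_nat_mult)
    qed
    have "(\<lambda>n. exp (- d) ^ n) \<longlonglongrightarrow> 0" using d by (intro LIMSEQ_realpow_zero) auto
    from LIMSEQ_subseq_LIMSEQ[OF this assms(11)]
    show "(\<lambda>k. exp (- d) ^ r k) \<longlonglongrightarrow> 0" by (simp add: comp_def)
  qed auto
  then have "(\<lambda>k. 1 - (?b k + exp (- (real (r k) * (h - d))) / exp (real (r k) * R (r k)))) \<longlonglongrightarrow> 1 - (0 + 0)"
    by (intro tendsto_diff tendsto_const tendsto_add b)
  then have lower: "(\<lambda>k. 1 - (?b k + exp (- (real (r k) * (h - d))) / exp (real (r k) * R (r k)))) \<longlonglongrightarrow> 1" by simp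
  show "?e \<longlonglongrightarrow> 1"
    by (rule tendsto_sandwich[OF _ _ lower tendsto_const]) (simp_all add: bounds)
qed

end
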